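(* Let $\gamma\in\{1,-1\}$, $\sigma\in(0,3/2]$, and let $a_n>0$, $b_n\in\mathbb R$ satisfy, as $n\to\infty$, $$a_n=n^\sigma(1+\alpha n^{-1}+O(n^{-2})),\qquad b_n=2\gamma n^\sigma(1+\beta n^{-1}+O(n^{-2})),$$ with $\alpha,\beta\in\mathbb R$; put $\tau=2\beta-2\alpha+\sigma$. Let one of the following three assumptions be satisfied: $1^0$ $\sigma\in(1,3/2]$ and either $\tau<0$ and $\Im z\ne0$, or $\tau>0$ and $z\in\mathbb C$ is arbitrary; $2^0$ $\sigma\in(0,1)$ and either $\gamma>0$ and $z\notin[0,\infty)$, or $\gamma<0$ and $z\notin(-\infty,0]$; $3^0$ $\sigma=1$ and either $\gamma>0$ and $z\notin[\tau,\infty)$, or $\gamma<0$ and $z\notin(-\infty,-\tau]$. Let $f(z)=(f_n(z))$ be the Jost solution of the equation $a_{n-1}F_{n-1}+b_nF_n+a_nF_{n+1}=zF_n$, $n\ge1$, i.e. the solution with $f_n(z)=(-\gamma)^nn^{-\rho}e^{i\varphi_n(\gamma z)}(1+o(1))$ as $n\to\infty$. Then an arbitrary solution $F(z)=(F_n(z))$ of this equation has the asymptotics, as $n\to\infty$, $$F_n(z)=-i\,W[F(z),f(z)]\,\varkappa(z)(-\gamma)^{n+1}n^{-\rho}e^{-i\varphi_n(\gamma z)}\bigl(1+o(1)\bigr),\qquad z\notin\operatorname{clos}\mathcal S.$$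
   Context: The Wronskian of two solutions $f,g$ of the equation is $W[f,g]=a_n(f_ng_{n+1}-f_{n+1}g_n)$; it does not depend on $n$. $\sqrt t$ is the analytic branch on $\mathbb C\setminus[0,\infty)$ with $\Im\sqrt t>0$. $\rho=\sigma/2-1/4$ if $\sigma\ge1$, $\rho=\sigma/4$ if $\sigma\le1$. For $n\ge1$ put $t_n(z)=-\tau n^{-1}+zn^{-\sigma}$. If $\sigma>1$, $\theta_n(z)=\sqrt{t_n(z)}$; if $\sigma=1$, $\theta_n(z)=\sqrt{z-\tau}\,n^{-1/2}$; if $\sigma<1$, $\theta_n(z)=\sqrt{T_n(z)}$, $T_n=t_n+\sum_{l=2}^Lp_lt_n^l$, where $L\ge1$ is a fixed integer with $(L+1/2)\sigma>1$ and the real numbers $p_2,\dots,p_L$ are determined by the requirement that, with $c_k=2(-1)^{k+1}/(2k)!$ and $P(t)=\sum_{l=2}^Lp_lt^l$, the polynomial $P(t)+\sum_{k=2}^Lc_k(P(t)+t)^k$ has no terms of degree $\le L$. $\varphi_n(z)=\sum_{m=N}^n\theta_m(z)$, where $N$ is a fixed integer, large enough (depending on the fixed $z$) that $\theta_m(\gamma z)$ is well defined for $m\ge N$. The number $\varkappa(z)$ is: $\pm\sqrt{|\tau|}$ if $\sigma>1$, $\tau<0$, $\pm\Im z\ge0$; $i\sqrt{\tau}$ if $\sigma>1$, $\tau>0$, $z\in\mathbb C$; $\sqrt z$ if $\sigma<1$, $z\in\operatorname{clos}(\mathbb C\setminus[0,\infty))$, $z\ne0$; $\sqrt{z-\tau}$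 if $\sigma=1$, $z\in\tau+\operatorname{clos}(\mathbb C\setminus[0,\infty))$, $z\ne\tau$. The set $\mathcal S$ is: $\mathbb R$ if $\sigma\in(1,3/2]$, $\tau<0$; $\emptyset$ if $\sigma\in(1,3/2]$, $\tau>0$; $\gamma(0,\infty)$ if $\sigma\in(0,1)$; $\gamma(\tau,\infty)$ if $\sigma=1$, where $\gamma(c,\infty)=\{\gamma x:x>c\}$. The Jost solution exists for all $z$ considered.
   Formalization: The coefficient ϰ(z) is corrected to 1/(2ϰ(γz)); the printed one fails e.g. for γ=σ=1, a_n=n, b_n=2n, z=-1, where ϰ=i√2. If W[F,f]=0 (e.g. F=f), the formula is read as F_n=o(n^{-ρ}e^{-iφ_n(γz)}). *)

theory Defs
  imports
    "HOL-Analysis.Analysis"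
    "HOL-Computational_Algebra.Polynomial"
    "HOL-Library.Landau_Symbols"
begin

(* Sequences are indexed by n = 0, 1, 2, ...; the equation is imposed for n >= 1, so
   F 0 and a 0 enter it and b 0 does not. *)

definition jacobi_solution ::
    "(nat \<Rightarrow> real) \<Rightarrow> (nat \<Rightarrow> real) \<Rightarrow> complex \<Rightarrow> (nat \<Rightarrow> complex) \<Rightarrow> bool"
  where "jacobi_solution a b z F \<longleftrightarrow>
    (\<forall>n\<ge>1. of_real (a (n - 1)) * F (n - 1) + of_real (b n) * F n + of_real (a n) * F (n + 1)
           = z * F n)"

definition wronskian ::
    "(nat \<Rightarrow> real) \<Rightarrow> (nat \<Rightarrow> complex) \<Rightarrow> (nat \<Rightarrow> complex) \<Rightarrow> nat \<Rightarrow> complex"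
  where "wronskian a f g n = of_real (a n) * (f n * g (n + 1) - f (n + 1) * g n)"

definition nonneg_axis :: "complex set"
  where "nonneg_axis = complex_of_real ` {0..}"

(* The branch of the square root that is analytic off [0,\<infinity>) and has positive imaginary
   part there.  On the cut itself the value is a junk value. *)

definition upper_sqrt :: "complex \<Rightarrow> complex"
  where "upper_sqrt t = \<i> * csqrt (- t)"

lemma upper_sqrt_power2: "(upper_sqrt t)\<^sup>2 = t"
  by (simp add: upper_sqrt_def power_mult_distrib)

lemma minus_notin_nonpos_Reals:
  assumes "t \<notin> nonneg_axis"
  shows "- t \<notin> \<real>\<^sub>\<le>\<^sub>0"
proof
  assume "- t \<in> \<real>\<^sub>\<le>\<^sub>0"
  then have "t = complex_of_real (Re t)" "0 \<le> Re t"
    by (auto simp: complex_nonpos_Reals_iff complex_eq_iff)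
  with assms show False
    unfolding nonneg_axis_def by auto
qed

lemma Im_upper_sqrt_pos:
  assumes "t \<notin> nonneg_axis"
  shows "0 < Im (upper_sqrt t)"
proof -
  have "Re (csqrt (- t)) \<noteq> 0"
  proof
    assume 0: "Re (csqrt (- t)) = 0"
    define y where "y = Im (csqrt (- t))"
    have "csqrt (- t) = \<i> * of_real y"
      using 0 by (simp add: complex_eq_iff y_def)
    then have "(csqrt (- t))\<^sup>2 = - of_real (y\<^sup>2)"
      by (simp add: power_mult_distrib)
    then have "t = of_real (y\<^sup>2)"
      by simp
    then have "t \<in> nonneg_axis"
      unfolding nonneg_axis_def by (rule image_eqI) simp
    with assms show False
      by contradiction
  qed
  then have "0 < Re (csqrt (- t))"
    using csqrt_principal[of "- t"] by auto
  then show ?thesis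
    by (simp add: upper_sqrt_def)
qed

lemma holomorphic_upper_sqrt: "upper_sqrt holomorphic_on (- nonneg_axis)"
  unfolding upper_sqrt_def
  by (intro holomorphic_intros) (auto dest: minus_notin_nonpos_Reals)

definition rho :: "real \<Rightarrow> real"
  where "rho \<sigma> = (if \<sigma> \<ge> 1 then \<sigma> / 2 - 1 / 4 else \<sigma> / 4)"

definition tn :: "real \<Rightarrow> real \<Rightarrow> nat \<Rightarrow> complex \<Rightarrow> complex"
  where "tn \<sigma> \<tau> n z = - of_real (\<tau> / real n) + z * of_real (real n powr (- \<sigma>))"

(* The coefficients of 2 - 2 cos x = x^2 + (\<Sum>k\<ge>2. c_k x^(2 k)). *)

definition cos_coef :: "nat \<Rightarrow> real"
  where "cos_coef k = 2 * (- 1) ^ (k + 1) / fact (2 * k)"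

definition phase_poly :: "nat \<Rightarrow> (nat \<Rightarrow> real) \<Rightarrow> real poly"
  where "phase_poly L p = (\<Sum>l=2..L. monom (p l) l)"

definition phase_coeffs :: "real \<Rightarrow> nat \<Rightarrow> (nat \<Rightarrow> real) \<Rightarrow> bool"
  where "phase_coeffs \<sigma> L p \<longleftrightarrow>
    1 \<le> L \<and> (real L + 1 / 2) * \<sigma> > 1 \<and>
    (\<forall>j\<le>L. coeff (phase_poly L p +
              (\<Sum>k=2..L. smult (cos_coef k) ((phase_poly L p + [:0, 1:]) ^ k))) j = 0)"

definition Tn :: "real \<Rightarrow> real \<Rightarrow> nat \<Rightarrow> (nat \<Rightarrow> real) \<Rightarrow> nat \<Rightarrow> complex \<Rightarrow> complex"
  where "Tn \<sigma> \<tau> L p n z = tn \<sigma> \<tau> n z + (\<Sum>l=2..L. of_real (p l) * tn \<sigma> \<tau> n z ^ l)"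

definition theta :: "real \<Rightarrow> real \<Rightarrow> nat \<Rightarrow> (nat \<Rightarrow> real) \<Rightarrow> nat \<Rightarrow> complex \<Rightarrow> complex"
  where "theta \<sigma> \<tau> L p n z =
    (if \<sigma> > 1 then upper_sqrt (tn \<sigma> \<tau> n z)
     else if \<sigma> = 1 then upper_sqrt (z - of_real \<tau>) * of_real (real n powr (- 1 / 2))
     else upper_sqrt (Tn \<sigma> \<tau> L p n z))"

(* theta is well defined when n \<ge> 1 and the argument of the root lies off the cut. *)

definition theta_defined :: "real \<Rightarrow> real \<Rightarrow> nat \<Rightarrow> (nat \<Rightarrow> real) \<Rightarrow> nat \<Rightarrow> complex \<Rightarrow> bool"
  where "theta_defined \<sigma> \<tau> L p n z \<longleftrightarrow> n \<ge> 1 \<and>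
    (if \<sigma> > 1 then tn \<sigma> \<tau> n z
     else if \<sigma> = 1 then z - of_real \<tau>
     else Tn \<sigma> \<tau> L p n z) \<notin> nonneg_axis"

definition phi :: "real \<Rightarrow> real \<Rightarrow> nat \<Rightarrow> (nat \<Rightarrow> real) \<Rightarrow> nat \<Rightarrow> nat \<Rightarrow> complex \<Rightarrow> complex"
  where "phi \<sigma> \<tau> L p N n z = (\<Sum>m=N..n. theta \<sigma> \<tau> L p m z)"

definition jost_solution ::
    "real \<Rightarrow> real \<Rightarrow> real \<Rightarrow> nat \<Rightarrow> (nat \<Rightarrow> real) \<Rightarrow> nat \<Rightarrow>
     (nat \<Rightarrow> real) \<Rightarrow> (nat \<Rightarrow> real) \<Rightarrow> complex \<Rightarrow> (nat \<Rightarrow> complex) \<Rightarrow> bool"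
  where "jost_solution \<gamma> \<sigma> \<tau> L p N a b z f \<longleftrightarrow>
    jacobi_solution a b z f \<and>
    f \<sim>[sequentially]
      (\<lambda>n. of_real ((- \<gamma>) ^ n * real n powr (- rho \<sigma>)) *
            exp (\<i> * phi \<sigma> \<tau> L p N n (of_real \<gamma> * z)))"

(* kappa is the leading coefficient of theta as n \<rightarrow> \<infinity>.  Hence, if
   f_n ~ (-\<gamma>)^n n^(-rho) exp (i phi_n(\<gamma> z))  and  g_n ~ (-\<gamma>)^(n+1) n^(-rho) exp (-i phi_n(\<gamma> z)),
   the Wronskian W[g,f] is 2 i kappa(\<gamma> z), and the coefficient of g in a solution F is
   W[F,f] / W[g,f] = -i W[F,f] / (2 kappa(\<gamma> z)).
   For \<sigma> > 1, \<tau> < 0 the two signs on the real axis belong to the two edges of the cut;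
   the definition keeps only the upper one.  The same holds for the remaining cuts, where
   upper_sqrt is junk.  For \<sigma> > 1, \<tau> = 0 kappa has no meaning. *)

definition kappa :: "real \<Rightarrow> real \<Rightarrow> complex \<Rightarrow> complex"
  where "kappa \<sigma> \<tau> z =
    (if \<sigma> > 1 then
       (if \<tau> < 0 then (if Im z \<ge> 0 then of_real (sqrt \<bar>\<tau>\<bar>) else - of_real (sqrt \<bar>\<tau>\<bar>))
        else \<i> * of_real (sqrt \<tau>))
     else if \<sigma> = 1 then upper_sqrt (z - of_real \<tau>)
     else upper_sqrt z)"

definition spectral_set :: "real \<Rightarrow> real \<Rightarrow> real \<Rightarrow> complex set"
  where "spectral_set \<gamma> \<sigma> \<tau> =
    (if \<sigma> > 1 then (if \<tau> < 0 then \<real> else {})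
     else if \<sigma> = 1 then (\<lambda>x. complex_of_real (\<gamma> * x)) ` {\<tau><..}
     else (\<lambda>x. complex_of_real (\<gamma> * x)) ` {0<..})"

end

theory Submission
  imports Defs "HOL-Real_Asymp.Real_Asymp"
begin

text \<open>
  The Jost solution \<open>f\<close> behaves like \<open>A n = (- \<gamma>) ^ n * n powr (- \<rho>) * exp (\<i> \<phi> n)\<close> with
  \<open>\<phi> (n + 1) - \<phi> n = \<theta> (n + 1)\<close>, and the claim is that every solution is, to leading order, a multiple
  of the counterpart \<open>B\<close> with \<open>- \<phi>\<close> in place of \<open>\<phi>\<close>, the multiple being \<open>W[F,f]\<close> divided by the
  limit \<open>- 2 \<i> \<gamma> \<kappa>\<close> of \<open>W[B,A]\<close>. Here \<open>\<kappa>\<close> is the leading coefficient of the phase increment,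
  \<open>\<theta> n \<approx> \<kappa> * n powr (2 * \<rho> - \<sigma>)\<close>. There are two regimes.

  If \<open>\<kappa>\<close> is not real (\<open>\<sigma> \<le> 1\<close>, or \<open>\<sigma> > 1\<close> and \<open>\<tau> > 0\<close>), the relative decay of \<open>A\<close> per
  step has the same order as the phase increment. Since \<open>W[F,f]\<close> is constant, \<open>F / f\<close> satisfies
  a first order recursion with known inhomogeneity, and a discrete l'Hospital rule
  (\<open>complex_recursion_limit\<close>) gives the limit from leading terms alone (\<open>asymptotics_nonreal_phase\<close>).

  If \<open>\<kappa>\<close> is real (\<open>\<sigma> > 1\<close> and \<open>\<tau> < 0\<close>), the oscillation has order \<open>n powr (- 1/2)\<close> per step and the decay
  only \<open>n powr (1/2 - \<sigma>)\<close>. The sum that represents \<open>F / f\<close> is then oscillatory, and an error \<open>o(1)\<close> in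
  \<open>f\<close> without a rate cannot be summed. Instead, \<open>A\<close> and \<open>B\<close> are used as approximate solutions. Their
  residuals, weighted suitably, are summable (\<open>relative_residual_bigo\<close>; the choice of \<open>\<rho>\<close> and
  \<open>\<tau>\<close> makes the terms of order \<open>1 / n\<close> and of order \<open>n powr (- 3/2)\<close> cancel). The Wronskians of a solution with
  \<open>A\<close> and \<open>B\<close> are its coordinates in this pair; in units of \<open>B\<close> they change by summable amounts, so the dominant
  coordinate converges and the recessive one is forgotten. Applied to both \<open>F\<close> and \<open>f\<close>, this
  identifies the limit of the dominant coordinate of \<open>F\<close> with \<open>W[F,f]\<close> (\<open>solution_over_B_tendsto\<close>). The
  factor \<open>exp (2 \<i> \<phi> n)\<close> tends to 0 because \<open>\<Sum> Im (\<theta> n)\<close> diverges, which is where \<open>\<sigma> \<le> 3/2\<close> enters.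
\<close>

section \<open>Wronskians and residuals\<close>

definition residual ::
    "(nat \<Rightarrow> real) \<Rightarrow> (nat \<Rightarrow> real) \<Rightarrow> complex \<Rightarrow> (nat \<Rightarrow> complex) \<Rightarrow> nat \<Rightarrow> complex"
  where "residual a b z X n =
    of_real (a (n - 1)) * X (n - 1) + (of_real (b n) - z) * X n + of_real (a n) * X (n + 1)"

text \<open>
  Summation by parts. An exact solution \<open>X\<close> has no residual, which makes the Wronskian constant;
  against an approximate solution the Wronskian drifts only as fast as the residual allows.
\<close>

lemma wronskian_step:
  assumes F: "jacobi_solution a b z F" and n: "n \<ge> 1"
  shows "wronskian a F X n - wronskian a F X (n - 1) = F n * residual a b z X n"
proof -
  have eq: "of_real (a n) * F (n + 1) =
      z * F n - of_real (b n) * F n - of_real (a (n - 1)) * F (n - 1)"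
    using F n unfolding jacobi_solution_def by (simp add: algebra_simps)
  have "wronskian a F X n =
      F n * (of_real (a n) * X (n + 1)) - (of_real (a n) * F (n + 1)) * X n"
    by (simp add: wronskian_def algebra_simps)
  with n show ?thesis
    unfolding eq by (simp add: wronskian_def residual_def algebra_simps)
qed

lemma wronskian_constant:
  assumes F: "jacobi_solution a b z F" and f: "jacobi_solution a b z f"
  shows "wronskian a F f n = wronskian a F f k"
proof -
  have step: "wronskian a F f (Suc m) = wronskian a F f m" for m
  proof -
    have "residual a b z f (Suc m) = 0"
      using f[unfolded jacobi_solution_def, rule_format, of "Suc m"]
      by (simp add: residual_def algebra_simps)
    then show ?thesis
      using wronskian_step[OF F, of "Suc m" f] by simp
  qed
  have "wronskian a F f m = wronskian a F f 0" for m
    by (induction m) (simp_all add: step)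
  then show ?thesis by metis
qed

section \<open>Contracting recursions\<close>

lemma filterlim_sum_at_top_if_not_summable:
  fixes d :: "nat \<Rightarrow> real"
  assumes "\<And>n. 0 \<le> d n" and "\<not> summable d"
  shows "filterlim (\<lambda>n. \<Sum>m<n. d m) at_top sequentially"
proof (subst filterlim_at_top, intro allI)
  fix Z :: real
  have "\<not> (\<forall>n. (\<Sum>m<n. d m) \<le> Z)"
    using assms summableI_nonneg_bounded[of d Z] by auto
  then obtain k where "Z < (\<Sum>m<k. d m)"
    by (auto simp: not_le)
  moreover have "(\<Sum>m<k. d m) \<le> (\<Sum>m<n. d m)" if "n \<ge> k" for n
    using that assms(1) by (intro sum_mono2) auto
  ultimately show "\<forall>\<^sub>F n in sequentially. Z \<le> (\<Sum>m<n. d m)"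
    by (intro eventually_sequentiallyI[of k]) fastforce
qed

text \<open>
  Once \<open>r < e/2\<close>, the excess of \<open>y\<close> over \<open>e/2\<close> is multiplied by at most \<open>1 - d n \<le> exp (- d n)\<close>
  at each step, and the product of these factors tends to 0 because \<open>\<Sum>d\<close> diverges.
\<close>

lemma contraction_to_zero:
  fixes y d r :: "nat \<Rightarrow> real"
  assumes y: "\<And>n. 0 \<le> y n"
    and d: "\<forall>\<^sub>F n in sequentially. 0 \<le> d n \<and> d n \<le> 1"
    and div: "\<not> summable d"
    and r: "r \<longlonglongrightarrow> 0"
    and step: "\<forall>\<^sub>F n in sequentially. y (Suc n) \<le> (1 - d n) * y n + d n * r n"
  shows "y \<longlonglongrightarrow> 0"
proof (rule tendstoI)
  fix e :: real assume e: "e > 0"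
  have "\<forall>\<^sub>F n in sequentially. r n < e / 2"
    using order_tendstoD(2)[OF r, of "e / 2"] e by simp
  with d step have "\<forall>\<^sub>F n in sequentially.
      0 \<le> d n \<and> d n \<le> 1 \<and> y (Suc n) - e / 2 \<le> (1 - d n) * (y n - e / 2)"
  proof eventually_elim
    case (elim n)
    then have "d n * r n \<le> d n * (e / 2)"
      by (intro mult_left_mono) auto
    with elim show ?case by (auto simp: algebra_simps diff_divide_distrib add_divide_distrib)
  qed
  then obtain k where k: "\<And>n. n \<ge> k \<Longrightarrow>
      0 \<le> d n \<and> d n \<le> 1 \<and> y (Suc n) - e / 2 \<le> (1 - d n) * (y n - e / 2)"
    by (auto simp: eventually_sequentially)
  define C where "C = y k + e"
  have bound: "y (k + n) - e / 2 \<le> C * exp (- (\<Sum>m<n. d (m + k)))" for n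
  proof (induction n)
    case 0
    then show ?case using e by (simp add: C_def)
  next
    case (Suc n)
    have C: "C \<ge> 0" using e y[of k] by (simp add: C_def)
    have "y (k + Suc n) - e / 2 \<le> (1 - d (n + k)) * (y (k + n) - e / 2)"
      using k[of "n + k"] by (simp add: add.commute)
    also have "\<dots> \<le> (1 - d (n + k)) * (C * exp (- (\<Sum>m<n. d (m + k))))"
      using k[of "n + k"] Suc by (intro mult_left_mono) auto
    also have "\<dots> \<le> exp (- d (n + k)) * (C * exp (- (\<Sum>m<n. d (m + k))))"
      using C exp_ge_add_one_self[of "- d (n + k)"] by (intro mult_right_mono) auto
    also have "\<dots> = C * exp (- (\<Sum>m<Suc n. d (m + k)))"
      by (simp add: exp_add[symmetric])
    finally show ?case .
  qed
  have "filterlim (\<lambda>n. \<Sum>m<n. d (m + k)) at_top sequentially"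
    using div k by (intro filterlim_sum_at_top_if_not_summable) (auto simp: summable_iff_shift)
  then have "(\<lambda>n. C * exp (- (\<Sum>m<n. d (m + k)))) \<longlonglongrightarrow> C * 0"
    by (intro tendsto_mult tendsto_const filterlim_compose[OF exp_at_bot]
        filterlim_compose[OF filterlim_uminus_at_bot_at_top])
  then have "\<forall>\<^sub>F n in sequentially. C * exp (- (\<Sum>m<n. d (m + k))) < e / 2"
    using e by (intro order_tendstoD(2)) auto
  then have "\<forall>\<^sub>F n in sequentially. y (n + k) < e"
  proof eventually_elim
    case (elim n)
    then show ?case using bound[of n] by (simp add: add.commute)
  qed
  then have "\<forall>\<^sub>F n in sequentially. y n < e"
    by (subst (asm) eventually_sequentially_seg)
  then show "\<forall>\<^sub>F n in sequentially. dist (y n) 0 < e"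
    by eventually_elim (use y in auto)
qed

text \<open>
  A discrete form of l'Hospital's rule. The recursion has the moving fixed point \<open>s n / \<omega> n\<close>, which
  tends to \<open>v / w\<close>; since \<open>Re w > 0\<close>, the distance to it is contracted by a factor of size
  \<open>1 - const * h n\<close>, and \<open>\<Sum>h\<close> diverges.
\<close>

lemma complex_recursion_limit:
  fixes x \<omega> s :: "nat \<Rightarrow> complex" and h :: "nat \<Rightarrow> real"
  assumes step: "\<forall>\<^sub>F n in sequentially. x (Suc n) = (1 - \<omega> n) * x n + s n"
    and \<omega>: "(\<lambda>n. \<omega> n / of_real (h n)) \<longlonglongrightarrow> w"
    and s: "(\<lambda>n. s n / of_real (h n)) \<longlonglongrightarrow> v"
    and w: "Re w > 0"
    and h: "\<And>n. h n \<ge> 0" "h \<longlonglongrightarrow> 0" "\<not> summable h" "\<forall>\<^sub>F n in sequentially. h n > 0"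
  shows "x \<longlonglongrightarrow> v / w"
proof -
  define c where "c = v / w"
  define r where "r = (\<lambda>n. norm (s n / of_real (h n) - c * (\<omega> n / of_real (h n))))"
  define q where "q = Re w / 4"
  have q: "q > 0" using w by (simp add: q_def)
  have w0: "w \<noteq> 0" using w by auto
  have r: "r \<longlonglongrightarrow> 0"
  proof -
    have "(\<lambda>n. s n / of_real (h n) - c * (\<omega> n / of_real (h n))) \<longlonglongrightarrow> v - c * w"
      by (intro tendsto_intros \<omega> s)
    then show ?thesis
      unfolding r_def using w0 by (simp add: c_def tendsto_norm_zero_iff)
  qed
  \<comment> \<open>\<open>|1 - h u|\<^sup>2 = 1 - 2 h Re u + h\<^sup>2 |u|\<^sup>2\<close>, and the linear term wins.\<close>
  have contr: "\<forall>\<^sub>F n in sequentially. norm (1 - \<omega> n) \<le> 1 - q * h n"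
  proof -
    have "(\<lambda>n. Re (\<omega> n / of_real (h n))) \<longlonglongrightarrow> Re w"
      using \<omega> by (intro tendsto_intros)
    then have e1: "\<forall>\<^sub>F n in sequentially. Re (\<omega> n / of_real (h n)) > 2 * q"
      using w by (intro order_tendstoD(1)) (auto simp: q_def)
    have "(\<lambda>n. h n * (norm (\<omega> n / of_real (h n)))\<^sup>2) \<longlonglongrightarrow> 0 * (norm w)\<^sup>2"
      by (intro tendsto_intros \<omega> h(2))
    then have e2: "\<forall>\<^sub>F n in sequentially. h n * (norm (\<omega> n / of_real (h n)))\<^sup>2 < 2 * q"
      using q by (intro order_tendstoD(2)) auto
    have "(\<lambda>n. q * h n) \<longlonglongrightarrow> q * 0"
      by (intro tendsto_intros h(2))
    then have e3: "\<forall>\<^sub>F n in sequentially. q * h n < 1"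
      by (intro order_tendstoD(2)) auto
    from e1 e2 e3 h(4) show ?thesis
    proof eventually_elim
      case (elim n)
      define u where "u = \<omega> n / of_real (h n)"
      have \<omega>u: "\<omega> n = of_real (h n) * u" using elim by (simp add: u_def)
      have "(norm (1 - \<omega> n))\<^sup>2 = 1 - 2 * h n * Re u + h n * (h n * (norm u)\<^sup>2)"
        unfolding \<omega>u cmod_power2 by (simp add: power2_eq_square algebra_simps)
      also have "\<dots> \<le> 1 - 2 * h n * (2 * q) + h n * (2 * q)"
        using elim by (intro add_mono diff_mono mult_left_mono) (auto simp: u_def)
      also have "\<dots> \<le> (1 - q * h n)\<^sup>2"
        using zero_le_power2[of "q * h n"] by (simp add: power2_eq_square algebra_simps)
      finally show ?case
        using elim by (auto intro: power2_le_imp_le)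
    qed
  qed
  have "(\<lambda>n. norm (x n - c)) \<longlonglongrightarrow> 0"
  proof (rule contraction_to_zero)
    show "\<forall>\<^sub>F n in sequentially. norm (x (Suc n) - c) \<le>
        (1 - q * h n) * norm (x n - c) + (q * h n) * (r n / q)"
      using contr step h(4)
    proof eventually_elim
      case (elim n)
      have "x (Suc n) - c = (1 - \<omega> n) * (x n - c) + (s n - c * \<omega> n)"
        using elim by (simp add: algebra_simps)
      then have "norm (x (Suc n) - c) \<le> norm (1 - \<omega> n) * norm (x n - c) + norm (s n - c * \<omega> n)"
        by (metis norm_triangle_ineq norm_mult)
      also have "\<dots> \<le> (1 - q * h n) * norm (x n - c) + norm (s n - c * \<omega> n)"
        using elim by (intro add_right_mono mult_right_mono) auto
      also have "norm (s n - c * \<omega> n) = h n * r n"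
      proof -
        have "s n - c * \<omega> n = of_real (h n) * (s n / of_real (h n) - c * (\<omega> n / of_real (h n)))"
          using elim by (simp add: field_simps)
        then show ?thesis using elim by (simp add: r_def norm_mult)
      qed
      finally show ?case using q by simp
    qed
    show "(\<lambda>n. r n / q) \<longlonglongrightarrow> 0"
      using tendsto_divide[OF r tendsto_const[of q]] q by simp
    show "\<not> summable (\<lambda>n. q * h n)"
      using h(3) q by (simp add: summable_cmult_iff)
    have "(\<lambda>n. q * h n) \<longlonglongrightarrow> q * 0"
      by (intro tendsto_intros h(2))
    then have "\<forall>\<^sub>F n in sequentially. q * h n < 1"
      by (intro order_tendstoD(2)) auto
    then show "\<forall>\<^sub>F n in sequentially. 0 \<le> q * h n \<and> q * h n \<le> 1"
      by eventually_elim (use q h(1) in auto)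
  qed auto
  then show ?thesis
    using tendsto_norm_zero_cancel LIM_zero_cancel by (fastforce simp: c_def)
qed

section \<open>Summable perturbations\<close>

lemma tail_suminf_tendsto_0:
  fixes g :: "nat \<Rightarrow> real"
  assumes "summable g"
  shows "(\<lambda>n. \<Sum>m. g (m + n)) \<longlonglongrightarrow> 0"
proof -
  have "(\<lambda>n. suminf g - (\<Sum>m<n. g m)) \<longlonglongrightarrow> suminf g - suminf g"
    by (intro tendsto_diff tendsto_const summable_LIMSEQ assms)
  then show ?thesis
    by (simp add: suminf_minus_initial_segment[OF assms])
qed

text \<open>
  The new value occurs on both sides of the inequality. It can be absorbed on the left as soon as
  \<open>h n < 1/2\<close>, at the price of the factor \<open>1 / (1 - h n) \<le> exp (2 * h n)\<close>.
\<close>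

lemma implicit_gronwall:
  fixes S h :: "nat \<Rightarrow> real"
  assumes S: "\<And>n. 0 \<le> S n" and sum: "summable h"
    and h: "\<forall>\<^sub>F n in sequentially. 0 \<le> h n"
    and step: "\<forall>\<^sub>F n in sequentially. S (Suc n) \<le> S n + h n * S (Suc n)"
  shows "\<exists>M. \<forall>\<^sub>F n in sequentially. S n \<le> M"
proof -
  have "\<forall>\<^sub>F n in sequentially. h n < 1 / 2"
    using summable_LIMSEQ_zero[OF sum] by (intro order_tendstoD(2)) auto
  with h step have "\<forall>\<^sub>F n in sequentially.
      0 \<le> h n \<and> h n < 1 / 2 \<and> S (Suc n) \<le> S n + h n * S (Suc n)"
    by eventually_elim auto
  then obtain k where k: "\<And>n. n \<ge> k \<Longrightarrow>
      0 \<le> h n \<and> h n < 1 / 2 \<and> S (Suc n) \<le> S n + h n * S (Suc n)"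
    unfolding eventually_sequentially by blast
  have bound: "S (k + n) \<le> S k * exp (2 * (\<Sum>m<n. h (m + k)))" for n
  proof (induction n)
    case (Suc n)
    define t where "t = h (n + k)"
    have t: "0 \<le> t" "t < 1 / 2" using k[of "n + k"] by (auto simp: t_def)
    have "t * t \<le> t * (1 / 2)" using t by (intro mult_left_mono) auto
    then have "1 \<le> (1 - t) * (1 + 2 * t)" by (simp add: algebra_simps)
    also have "\<dots> \<le> (1 - t) * exp (2 * t)"
      using t by (intro mult_left_mono) auto
    finally have one: "1 \<le> (1 - t) * exp (2 * t)" .
    have "S (k + Suc n) \<le> S (k + Suc n) * ((1 - t) * exp (2 * t))"
      using mult_left_mono[OF one S[of "k + Suc n"]] by simp
    also have "\<dots> = (S (k + Suc n) * (1 - t)) * exp (2 * t)"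
      by simp
    also have "\<dots> \<le> S (k + n) * exp (2 * t)"
      using k[of "n + k"] by (intro mult_right_mono) (auto simp: t_def algebra_simps)
    also have "\<dots> \<le> S k * exp (2 * (\<Sum>m<n. h (m + k))) * exp (2 * t)"
      by (intro mult_right_mono Suc) auto
    finally show ?case
      by (simp add: t_def exp_add algebra_simps)
  qed simp
  have "S n \<le> S k * exp (2 * (\<Sum>m. h (m + k)))" if "n \<ge> k" for n
  proof -
    have "S n \<le> S k * exp (2 * (\<Sum>m<n-k. h (m + k)))"
      using bound[of "n - k"] that by simp
    also have "\<dots> \<le> S k * exp (2 * (\<Sum>m. h (m + k)))"
      using k sum S[of k]
      by (intro mult_left_mono) (auto intro!: sum_le_suminf summable_ignore_initial_segment)
    finally show ?thesis .
  qed
  then show ?thesis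
    by (auto intro!: exI eventually_sequentiallyI)
qed

text \<open>
  Divided by \<open>r\<close>, the sequence grows by \<open>g n / r (Suc n)\<close>. Since \<open>r\<close> decreases, a contribution made
  at time \<open>m\<close> is at most \<open>g m\<close> later on, so late contributions are bounded by a tail of \<open>\<Sum>g\<close>, and
  the early ones are forgotten because \<open>r\<close> tends to 0.
\<close>

lemma weighted_contraction_to_zero:
  fixes y r g :: "nat \<Rightarrow> real"
  assumes y: "\<And>n. 0 \<le> y n"
    and r: "\<forall>\<^sub>F n in sequentially. 0 < r n \<and> r (Suc n) \<le> r n" "r \<longlonglongrightarrow> 0"
    and g: "\<forall>\<^sub>F n in sequentially. 0 \<le> g n" "summable g"
    and step: "\<forall>\<^sub>F n in sequentially. y (Suc n) \<le> r (Suc n) / r n * y n + g n"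
  shows "y \<longlonglongrightarrow> 0"
proof (rule tendstoI)
  fix \<epsilon> :: real assume \<epsilon>: "\<epsilon> > 0"
  have "\<forall>\<^sub>F n in sequentially. (\<Sum>m. g (m + n)) < \<epsilon> / 2"
    using tail_suminf_tendsto_0[OF g(2)] \<epsilon> by (intro order_tendstoD(2)) auto
  with r(1) g(1) step have "\<forall>\<^sub>F n in sequentially. (\<Sum>m. g (m + n)) < \<epsilon> / 2 \<and>
      0 < r n \<and> r (Suc n) \<le> r n \<and> 0 \<le> g n \<and> y (Suc n) \<le> r (Suc n) / r n * y n + g n"
    by eventually_elim auto
  then obtain k where "\<And>n. n \<ge> k \<Longrightarrow> (\<Sum>m. g (m + n)) < \<epsilon> / 2 \<and>
      0 < r n \<and> r (Suc n) \<le> r n \<and> 0 \<le> g n \<and> y (Suc n) \<le> r (Suc n) / r n * y n + g n"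
    unfolding eventually_sequentially by blast
  then have tail: "(\<Sum>m. g (m + k)) < \<epsilon> / 2" and k: "\<And>n. n \<ge> k \<Longrightarrow>
      0 < r n \<and> r (Suc n) \<le> r n \<and> 0 \<le> g n \<and> y (Suc n) \<le> r (Suc n) / r n * y n + g n"
    by auto
  have bound: "y (k + n) \<le> r (k + n) / r k * y k + (\<Sum>m<n. g (m + k))" for n
  proof (induction n)
    case 0
    then show ?case using k[of k] by auto
  next
    case (Suc n)
    define G where "G = (\<Sum>m<n. g (m + k))"
    have kn: "0 < r (k + n)" "r (Suc (k + n)) \<le> r (k + n)" "0 < r (Suc (k + n))" "0 < r k"
      using k[of "k + n"] k[of "Suc (k + n)"] k[of k] by auto
    have G: "0 \<le> G"
      unfolding G_def using k by (intro sum_nonneg) auto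
    have "y (k + Suc n) \<le> r (Suc (k + n)) / r (k + n) * y (k + n) + g (k + n)"
      using k[of "k + n"] by simp
    also have "\<dots> \<le> r (Suc (k + n)) / r (k + n) * (r (k + n) / r k * y k + G) + g (k + n)"
      using Suc kn by (intro add_right_mono mult_left_mono) (auto simp: G_def)
    also have "\<dots> = r (Suc (k + n)) / r k * y k + r (Suc (k + n)) / r (k + n) * G + g (k + n)"
      using kn by (simp add: field_simps)
    also have "\<dots> \<le> r (Suc (k + n)) / r k * y k + 1 * G + g (k + n)"
      using kn G by (intro add_right_mono add_left_mono mult_right_mono) auto
    finally show ?case by (simp add: G_def add.commute)
  qed
  have "(\<lambda>n. r (k + n) / r k * y k + \<epsilon> / 2) \<longlonglongrightarrow> 0 / r k * y k + \<epsilon> / 2"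
    using k[of k] LIMSEQ_ignore_initial_segment[OF r(2), of k]
    by (intro tendsto_intros) (auto simp: add.commute)
  then have "\<forall>\<^sub>F n in sequentially. r (k + n) / r k * y k + \<epsilon> / 2 < \<epsilon>"
    by (rule order_tendstoD(2)) (use \<epsilon> in simp)
  then have "\<forall>\<^sub>F n in sequentially. y (n + k) < \<epsilon>"
  proof eventually_elim
    case (elim n)
    have "(\<Sum>m<n. g (m + k)) \<le> (\<Sum>m. g (m + k))"
      using k g(2) by (intro sum_le_suminf summable_ignore_initial_segment) auto
    then show ?case using bound[of n] elim tail by (simp add: add.commute)
  qed
  then have "\<forall>\<^sub>F n in sequentially. y n < \<epsilon>"
    by (subst (asm) eventually_sequentially_seg)
  then show "\<forall>\<^sub>F n in sequentially. dist (y n) 0 < \<epsilon>"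
    by eventually_elim (use y in auto)
qed

section \<open>Solutions relative to a pair of approximate solutions\<close>

text \<open>
  A recessive approximate solution \<open>A\<close> and a dominant one \<open>B\<close>, with ratio \<open>e = A / B\<close>. The
  modulus of \<open>e\<close> decreases to 0, possibly much more slowly than \<open>e\<close> rotates. The residuals are
  measured after multiplication by the other member of the pair, which is the size in which they
  act on the two Wronskians of a solution.
\<close>

locale approximate_solution_pair =
  fixes a b :: "nat \<Rightarrow> real" and z :: complex
    and A B e :: "nat \<Rightarrow> complex" and \<eta> :: "nat \<Rightarrow> real" and w :: complex
  assumes nonzero: "\<forall>\<^sub>F n in sequentially. B n \<noteq> 0 \<and> e n \<noteq> 0"
    and A_eq: "\<forall>\<^sub>F n in sequentially. A n = e n * B n"
    and e_decreasing: "\<forall>\<^sub>F n in sequentially. norm (e (Suc n)) \<le> norm (e n)"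
    and e_lim: "e \<longlonglongrightarrow> 0"
    and \<eta>_summable: "summable \<eta>"
    and residual_A: "\<forall>\<^sub>F n in sequentially. norm (B n * residual a b z A n) \<le> \<eta> n"
    and residual_B: "\<forall>\<^sub>F n in sequentially. norm (A n * residual a b z B n) \<le> \<eta> n"
    and wronskian_lim: "wronskian a B A \<longlonglongrightarrow> w"
    and w_nonzero: "w \<noteq> 0"
begin

lemma \<eta>_nonneg: "\<forall>\<^sub>F n in sequentially. 0 \<le> \<eta> n"
  using residual_A by eventually_elim (meson norm_ge_zero order_trans)

lemma \<eta>_Suc: "summable (\<lambda>n. \<eta> (Suc n))" "\<forall>\<^sub>F n in sequentially. 0 \<le> \<eta> (Suc n)"
  using \<eta>_summable eventually_sequentially_Suc[of "\<lambda>n. 0 \<le> \<eta> n"] \<eta>_nonneg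
  by (simp_all add: summable_Suc_iff)

lemma wronskian_nonzero: "\<forall>\<^sub>F n in sequentially. wronskian a B A n \<noteq> 0"
  using wronskian_lim w_nonzero by (rule tendsto_imp_eventually_ne)

text \<open>
  Variation of constants: \<open>W[F,A]\<close> and \<open>W[F,B]\<close> are, up to sign and normalization, the coordinates
  of \<open>F\<close> with respect to \<open>B\<close> and \<open>A\<close>.
\<close>

lemma decomposition:
  "F n * wronskian a B A n = wronskian a F A n * B n - wronskian a F B n * A n"
  by (simp add: wronskian_def algebra_simps)

lemma quotient_B:
  "\<forall>\<^sub>F n in sequentially. F n / B n =
    (wronskian a F A n - e n * wronskian a F B n) / wronskian a B A n"
  using nonzero A_eq wronskian_nonzero
proof eventually_elim
  case (elim n)
  then show ?case using decomposition[of F n] by (simp add: field_simps)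
qed

text \<open>
  Both coordinates of an exact solution change by \<open>F\<close> times a residual, and \<open>F\<close> is itself controlled
  by the coordinates. The second coordinate is rescaled by \<open>e\<close> so that both are measured in units of
  the dominant solution \<open>B\<close>.
\<close>

lemma amplitudes_step:
  assumes F: "jacobi_solution a b z F"
  defines "P \<equiv> wronskian a F A" and "q \<equiv> \<lambda>n. e n * wronskian a F B n"
  obtains c where "c \<ge> 0"
    "\<forall>\<^sub>F n in sequentially. norm (P (Suc n) - P n) \<le>
        c * \<eta> (Suc n) * (norm (P (Suc n)) + norm (q (Suc n)))"
    "\<forall>\<^sub>F n in sequentially. norm (q (Suc n)) \<le> norm (e (Suc n)) / norm (e n) * norm (q n) +
        c * \<eta> (Suc n) * (norm (P (Suc n)) + norm (q (Suc n)))"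
proof -
  define c where "c = 2 / norm w"
  have c: "c > 0" using w_nonzero by (simp add: c_def)
  have "(\<lambda>n. norm (wronskian a B A n)) \<longlonglongrightarrow> norm w"
    by (intro tendsto_norm wronskian_lim)
  then have "\<forall>\<^sub>F n in sequentially. norm w / 2 < norm (wronskian a B A n)"
    using w_nonzero by (intro order_tendstoD(1)) auto
  then have F_bound: "\<forall>\<^sub>F n in sequentially. norm (F n) \<le> c * norm (B n) * (norm (P n) + norm (q n))"
    using nonzero quotient_B[of F]
  proof eventually_elim
    case (elim n)
    have "norm (F n) = norm (B n) * norm (F n / B n)"
      using elim(2) by (simp add: norm_divide)
    also have "norm (F n / B n) = norm (P n - q n) * (1 / norm (wronskian a B A n))"
      using elim by (simp add: P_def q_def norm_divide)
    also have "\<dots> \<le> (norm (P n) + norm (q n)) * c"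
      using frac_le[of 1 1 "norm w / 2" "norm (wronskian a B A n)"] elim(1) w_nonzero
      by (intro mult_mono norm_triangle_ineq4) (auto simp: c_def)
    finally have "norm (F n) \<le> norm (B n) * ((norm (P n) + norm (q n)) * c)"
      by (simp add: mult_left_mono)
    then show ?case by (simp add: mult_ac)
  qed
  show thesis
  proof
    show "c \<ge> 0" using c by simp
    have shift: "\<forall>\<^sub>F n in sequentially. X (Suc n)" if "\<forall>\<^sub>F n in sequentially. X n" for X
      using that eventually_sequentially_Suc[of X] by simp
    show "\<forall>\<^sub>F n in sequentially. norm (P (Suc n) - P n) \<le>
        c * \<eta> (Suc n) * (norm (P (Suc n)) + norm (q (Suc n)))"
      using shift[OF F_bound] shift[OF residual_A]
    proof eventually_elim
      case (elim n)
      have "norm (P (Suc n) - P n) = norm (F (Suc n)) * norm (residual a b z A (Suc n))"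
        using wronskian_step[OF F, of "Suc n" A] by (simp add: P_def norm_mult)
      also have "\<dots> \<le> c * norm (B (Suc n)) * (norm (P (Suc n)) + norm (q (Suc n)))
          * norm (residual a b z A (Suc n))"
        using elim by (intro mult_right_mono) auto
      also have "\<dots> = c * norm (B (Suc n) * residual a b z A (Suc n))
          * (norm (P (Suc n)) + norm (q (Suc n)))"
        by (simp add: norm_mult)
      also have "\<dots> \<le> c * \<eta> (Suc n) * (norm (P (Suc n)) + norm (q (Suc n)))"
        using elim c by (intro mult_right_mono mult_left_mono) auto
      finally show ?case .
    qed
    show "\<forall>\<^sub>F n in sequentially. norm (q (Suc n)) \<le> norm (e (Suc n)) / norm (e n) * norm (q n) +
        c * \<eta> (Suc n) * (norm (P (Suc n)) + norm (q (Suc n)))"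
      using shift[OF F_bound] shift[OF residual_B] shift[OF A_eq] nonzero
    proof eventually_elim
      case (elim n)
      have "q (Suc n) = e (Suc n) / e n * q n + e (Suc n) * (F (Suc n) * residual a b z B (Suc n))"
        using wronskian_step[OF F, of "Suc n" B] elim by (simp add: q_def algebra_simps)
      then have "norm (q (Suc n)) \<le> norm (e (Suc n)) / norm (e n) * norm (q n) +
          norm (e (Suc n)) * (norm (F (Suc n)) * norm (residual a b z B (Suc n)))"
        by (metis norm_triangle_ineq norm_mult norm_divide)
      also have "norm (e (Suc n)) * (norm (F (Suc n)) * norm (residual a b z B (Suc n))) \<le>
          norm (e (Suc n)) * ((c * norm (B (Suc n)) * (norm (P (Suc n)) + norm (q (Suc n))))
            * norm (residual a b z B (Suc n)))"
        using elim by (intro mult_left_mono mult_right_mono) auto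
      also have "\<dots> = c * norm (A (Suc n) * residual a b z B (Suc n))
          * (norm (P (Suc n)) + norm (q (Suc n)))"
        using elim by (simp add: norm_mult)
      also have "\<dots> \<le> c * \<eta> (Suc n) * (norm (P (Suc n)) + norm (q (Suc n)))"
        using elim c by (intro mult_right_mono mult_left_mono) auto
      finally show ?case by simp
    qed
  qed
qed

text \<open>
  The Gronwall bound keeps both amplitudes bounded; the increments of the dominant amplitude are then
  summable, and the rescaled recessive amplitude is forgotten.
\<close>

lemma amplitudes_limit:
  assumes F: "jacobi_solution a b z F"
  shows "convergent (wronskian a F A)" and "(\<lambda>n. e n * wronskian a F B n) \<longlonglongrightarrow> 0"
proof -
  define P where "P = wronskian a F A"
  define q where "q = (\<lambda>n. e n * wronskian a F B n)"
  obtain c where c: "c \<ge> 0" and P_step: "\<forall>\<^sub>F n in sequentially. norm (P (Suc n) - P n) \<le>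
        c * \<eta> (Suc n) * (norm (P (Suc n)) + norm (q (Suc n)))"
    and q_step: "\<forall>\<^sub>F n in sequentially. norm (q (Suc n)) \<le>
        norm (e (Suc n)) / norm (e n) * norm (q n) +
        c * \<eta> (Suc n) * (norm (P (Suc n)) + norm (q (Suc n)))"
    unfolding P_def q_def by (rule amplitudes_step[OF F])
  have "\<exists>M. \<forall>\<^sub>F n in sequentially. norm (P n) + norm (q n) \<le> M"
  proof (rule implicit_gronwall)
    show "summable (\<lambda>n. 2 * c * \<eta> (Suc n))"
      by (intro summable_mult \<eta>_Suc)
    show "\<forall>\<^sub>F n in sequentially. 0 \<le> 2 * c * \<eta> (Suc n)"
      using \<eta>_Suc(2) by eventually_elim (use c in auto)
    show "\<forall>\<^sub>F n in sequentially. norm (P (Suc n)) + norm (q (Suc n)) \<le>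
        norm (P n) + norm (q n) + 2 * c * \<eta> (Suc n) * (norm (P (Suc n)) + norm (q (Suc n)))"
      using P_step q_step e_decreasing nonzero
    proof eventually_elim
      case (elim n)
      have "norm (P (Suc n)) \<le> norm (P n) + norm (P (Suc n) - P n)"
        by (rule norm_triangle_sub)
      moreover have "norm (e (Suc n)) / norm (e n) * norm (q n) \<le> 1 * norm (q n)"
        using elim by (intro mult_right_mono) auto
      ultimately show ?case using elim by linarith
    qed
  qed auto
  then obtain M where "\<forall>\<^sub>F n in sequentially. norm (P n) + norm (q n) \<le> M"
    by blast
  then have M: "\<forall>\<^sub>F n in sequentially. norm (P (Suc n)) + norm (q (Suc n)) \<le> M"
    using eventually_sequentially_Suc[of "\<lambda>n. norm (P n) + norm (q n) \<le> M"] by simp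
  have g: "\<forall>\<^sub>F n in sequentially.
      c * \<eta> (Suc n) * (norm (P (Suc n)) + norm (q (Suc n))) \<le> c * M * \<eta> (Suc n)"
    using M \<eta>_Suc(2)
  proof eventually_elim
    case (elim n)
    then show ?case
      using mult_left_mono[OF elim(1), of "c * \<eta> (Suc n)"] c by (simp add: mult_ac)
  qed
  have g_sum: "summable (\<lambda>n. c * M * \<eta> (Suc n))"
    by (intro summable_mult \<eta>_Suc)
  have "summable (\<lambda>n. P (Suc n) - P n)"
  proof (rule summable_comparison_test_ev[OF _ g_sum])
    show "\<forall>\<^sub>F n in sequentially. norm (P (Suc n) - P n) \<le> c * M * \<eta> (Suc n)"
      using P_step g by eventually_elim linarith
  qed
  then have "convergent (\<lambda>n. (\<Sum>m<n. P (Suc m) - P m) + P 0)"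
    by (intro convergent_add convergent_const) (simp add: summable_iff_convergent)
  then show "convergent (wronskian a F A)"
    by (simp add: sum_lessThan_telescope P_def)
  have "(\<lambda>n. norm (q n)) \<longlonglongrightarrow> 0"
  proof (rule weighted_contraction_to_zero[where r = "\<lambda>n. norm (e n)"])
    show "\<forall>\<^sub>F n in sequentially. 0 < norm (e n) \<and> norm (e (Suc n)) \<le> norm (e n)"
      using nonzero e_decreasing by eventually_elim auto
    show "(\<lambda>n. norm (e n)) \<longlonglongrightarrow> 0"
      using e_lim by (rule tendsto_norm_zero)
    show "\<forall>\<^sub>F n in sequentially. norm (q (Suc n)) \<le>
        norm (e (Suc n)) / norm (e n) * norm (q n) + c * M * \<eta> (Suc n)"
      using q_step g by eventually_elim linarith
    show "\<forall>\<^sub>F n in sequentially. 0 \<le> c * M * \<eta> (Suc n)"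
      using M \<eta>_Suc(2)
    proof eventually_elim
      case (elim n)
      have "0 \<le> M" using elim(1) by (smt (verit) norm_ge_zero)
      then show ?case using elim c by simp
    qed
  qed (use g_sum in auto)
  then show "(\<lambda>n. e n * wronskian a F B n) \<longlonglongrightarrow> 0"
    unfolding q_def by (rule tendsto_norm_zero_cancel)
qed

lemma quotient_B_tendsto:
  assumes F: "jacobi_solution a b z F"
  shows "(\<lambda>n. F n / B n) \<longlonglongrightarrow> lim (wronskian a F A) / w"
proof -
  have "(\<lambda>n. (wronskian a F A n - e n * wronskian a F B n) / wronskian a B A n)
      \<longlonglongrightarrow> (lim (wronskian a F A) - 0) / w"
    using amplitudes_limit[OF F] wronskian_lim w_nonzero
    by (intro tendsto_intros) (auto simp: convergent_LIMSEQ_iff)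
  then show ?thesis
    using quotient_B[of F] by (simp add: filterlim_cong)
qed

text \<open>
  A solution \<open>f\<close> that is asymptotic to \<open>A\<close> has no dominant component, so its dominant amplitude equals
  minus the sum of its future increments. These are at most \<open>2 * |e m| * \<eta> m\<close> with \<open>|e m| \<le> |e n|\<close>,
  which makes the amplitude small even compared with \<open>e n\<close>. This is the point where knowing \<open>f\<close> to
  leading order suffices, although \<open>W[F,f]\<close> involves cancellation between consecutive terms.
\<close>

lemma recessive_amplitude:
  assumes f: "jacobi_solution a b z f" and fA: "(\<lambda>n. f n / A n) \<longlonglongrightarrow> 1"
  shows "(\<lambda>n. wronskian a f A n / e n) \<longlonglongrightarrow> 0"
proof -
  define P where "P = wronskian a f A"
  have "(\<lambda>n. f n / A n * e n) \<longlonglongrightarrow> 1 * 0"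
    by (intro tendsto_intros fA e_lim)
  moreover have "\<forall>\<^sub>F n in sequentially. f n / A n * e n = f n / B n"
    using A_eq nonzero by eventually_elim auto
  ultimately have "(\<lambda>n. f n / B n) \<longlonglongrightarrow> 0"
    by (simp add: filterlim_cong)
  with quotient_B_tendsto[OF f] have "lim P / w = 0"
    unfolding P_def by (rule LIMSEQ_unique)
  then have P_lim: "P \<longlonglongrightarrow> 0"
    using amplitudes_limit(1)[OF f] w_nonzero by (simp add: P_def convergent_LIMSEQ_iff)
  have "(\<lambda>n. norm (f n / A n)) \<longlonglongrightarrow> norm (1::complex)"
    by (intro tendsto_norm fA)
  then have "\<forall>\<^sub>F n in sequentially. norm (f n / A n) < 2"
    by (intro order_tendstoD(2)) auto
  then have "\<forall>\<^sub>F n in sequentially. norm (f n * residual a b z A n) \<le> 2 * (norm (e n) * \<eta> n)"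
    using A_eq nonzero residual_A
  proof eventually_elim
    case (elim n)
    have "norm (f n * residual a b z A n) =
        norm (f n / A n) * (norm (e n) * norm (B n * residual a b z A n))"
      using elim by (simp add: norm_mult norm_divide)
    also have "\<dots> \<le> 2 * (norm (e n) * \<eta> n)"
      using elim by (intro mult_mono) auto
    finally show ?case .
  qed
  then have "\<forall>\<^sub>F n in sequentially.
      norm (f n * residual a b z A n) \<le> 2 * (norm (e n) * \<eta> n) \<and>
      norm (e (Suc n)) \<le> norm (e n) \<and> 0 \<le> \<eta> n \<and> e n \<noteq> 0"
    using e_decreasing \<eta>_nonneg nonzero by eventually_elim auto
  then obtain k where k: "\<And>n. n \<ge> k \<Longrightarrow>
      norm (f n * residual a b z A n) \<le> 2 * (norm (e n) * \<eta> n) \<and>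
      norm (e (Suc n)) \<le> norm (e n) \<and> 0 \<le> \<eta> n \<and> e n \<noteq> 0"
    unfolding eventually_sequentially by blast
  have e_mono: "norm (e (n + j)) \<le> norm (e n)" if "n \<ge> k" for n j
  proof (induction j)
    case (Suc j)
    then show ?case using k[of "n + j"] that by (auto intro: order_trans)
  qed simp
  have bound: "norm (P n / e n) \<le> 2 * (\<Sum>m. \<eta> (m + n))" if n: "n \<ge> k" for n
  proof -
    \<comment> \<open>Sum the increments from \<open>n\<close> to \<open>n + j\<close>; \<open>j\<close> tends to infinity afterwards.\<close>
    have "norm (P n) \<le> norm (P (n + j)) + 2 * norm (e n) * (\<Sum>m<j. \<eta> (Suc m + n))" for j
    proof (induction j)
      case (Suc j)
      have "norm (P (n + j)) \<le> norm (P (Suc (n + j))) + norm (P (Suc (n + j)) - P (n + j))"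
        by (metis norm_minus_commute norm_triangle_sub)
      also have "P (Suc (n + j)) - P (n + j) = f (Suc (n + j)) * residual a b z A (Suc (n + j))"
        using wronskian_step[OF f, of "Suc (n + j)" A] by (simp add: P_def)
      also have "norm \<dots> \<le> 2 * (norm (e (Suc (n + j))) * \<eta> (Suc (n + j)))"
        using k[of "Suc (n + j)"] n by auto
      also have "\<dots> \<le> 2 * (norm (e n) * \<eta> (Suc (n + j)))"
        using e_mono[OF n, of "Suc j"] k[of "Suc (n + j)"] n
        by (intro mult_left_mono mult_right_mono) auto
      finally show ?case using Suc by (simp add: algebra_simps)
    qed simp
    moreover have "(\<Sum>m<j. \<eta> (Suc m + n)) \<le> (\<Sum>m. \<eta> (m + n))" for j
    proof -
      have "(\<Sum>m<j. \<eta> (Suc m + n)) \<le> (\<Sum>m<Suc j. \<eta> (m + n))"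
        using k[of n] n by (subst sum.lessThan_Suc_shift) auto
      also have "\<dots> \<le> (\<Sum>m. \<eta> (m + n))"
        using k n \<eta>_summable by (intro sum_le_suminf summable_ignore_initial_segment) auto
      finally show ?thesis .
    qed
    ultimately have "norm (P n) \<le> norm (P (n + j)) + 2 * norm (e n) * (\<Sum>m. \<eta> (m + n))" for j
      by (meson add_left_mono mult_left_mono mult_nonneg_nonneg norm_ge_zero order_trans
          zero_le_numeral)
    moreover have "(\<lambda>j. norm (P (n + j)) + 2 * norm (e n) * (\<Sum>m. \<eta> (m + n)))
        \<longlonglongrightarrow> norm (0::complex) + 2 * norm (e n) * (\<Sum>m. \<eta> (m + n))"
      using LIMSEQ_ignore_initial_segment[OF P_lim, of n]
      by (intro tendsto_intros) (simp add: add.commute)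
    ultimately have "norm (P n) \<le> 2 * norm (e n) * (\<Sum>m. \<eta> (m + n))"
      by (auto intro: LIMSEQ_le_const)
    then show ?thesis
      using k[OF n] by (simp add: norm_divide field_simps)
  qed
  have "(\<lambda>n. P n / e n) \<longlonglongrightarrow> 0"
  proof (rule Lim_null_comparison)
    show "\<forall>\<^sub>F n in sequentially. norm (P n / e n) \<le> 2 * (\<Sum>m. \<eta> (m + n))"
      using bound by (rule eventually_sequentiallyI)
    show "(\<lambda>n. 2 * (\<Sum>m. \<eta> (m + n))) \<longlonglongrightarrow> 0"
      using tendsto_mult[OF tendsto_const tail_suminf_tendsto_0[OF \<eta>_summable], of 2] by simp
  qed
  then show ?thesis by (simp add: P_def)
qed

text \<open>
  Write \<open>W[F,f]\<close> in the coordinates of \<open>F\<close> and \<open>f\<close>. As the dominant amplitude of \<open>f\<close> is negligible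
  and its recessive amplitude tends to \<open>- w\<close>, the constant \<open>W[F,f]\<close> is the limit of the
  dominant amplitude of \<open>F\<close>.
\<close>

lemma solution_over_B_tendsto:
  assumes F: "jacobi_solution a b z F" and f: "jacobi_solution a b z f"
    and fA: "(\<lambda>n. f n / A n) \<longlonglongrightarrow> 1"
  shows "(\<lambda>n. F n / B n) \<longlonglongrightarrow> wronskian a F f k / w"
proof -
  define V where "V = wronskian a B A"
  have V: "V \<longlonglongrightarrow> w" unfolding V_def by (rule wronskian_lim)
  have Qf: "(\<lambda>n. wronskian a f B n) \<longlonglongrightarrow> 0 - 1 * w"
  proof -
    have "(\<lambda>n. wronskian a f A n / e n - f n / A n * V n) \<longlonglongrightarrow> 0 - 1 * w"
      by (intro tendsto_intros recessive_amplitude[OF f fA] fA V)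
    moreover have "\<forall>\<^sub>F n in sequentially.
        wronskian a f A n / e n - f n / A n * V n = wronskian a f B n"
      using A_eq nonzero
    proof eventually_elim
      case (elim n)
      then show ?case
        using decomposition[of f n] by (simp add: V_def field_simps)
    qed
    ultimately show ?thesis by (simp add: filterlim_cong)
  qed
  have "(\<lambda>n. ((e n * wronskian a F B n) * (wronskian a f A n / e n)
      - wronskian a F A n * wronskian a f B n) / V n)
      \<longlonglongrightarrow> (0 * 0 - lim (wronskian a F A) * (0 - 1 * w)) / w"
    using amplitudes_limit[OF F] w_nonzero
    by (intro tendsto_intros recessive_amplitude[OF f fA] Qf V) (auto simp: convergent_LIMSEQ_iff)
  moreover have "\<forall>\<^sub>F n in sequentially.
      ((e n * wronskian a F B n) * (wronskian a f A n / e n)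
      - wronskian a F A n * wronskian a f B n) / V n = wronskian a F f k"
    using nonzero wronskian_nonzero
  proof eventually_elim
    case (elim n)
    have "wronskian a F B n * wronskian a f A n - wronskian a F A n * wronskian a f B n
        = wronskian a F f n * V n"
      by (simp add: wronskian_def V_def algebra_simps)
    with elim show ?case
      using wronskian_constant[OF F f, of n k] by (simp add: V_def field_simps)
  qed
  ultimately have "(\<lambda>n::nat. wronskian a F f k) \<longlonglongrightarrow> lim (wronskian a F A)"
    using w_nonzero by (simp add: filterlim_cong)
  then have "wronskian a F f k = lim (wronskian a F A)"
    by (simp add: LIMSEQ_const_iff)
  then show ?thesis
    using quotient_B_tendsto[OF F] by simp
qed

end

section \<open>The exponential ansatz and its leading terms\<close>

text \<open>
  With \<open>\<psi> = \<phi>\<close> and \<open>\<psi> = - \<phi>\<close> this is the leading term of the Jost solution and of its growing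
  counterpart. The phase is complex in general.
\<close>

definition wkb_ansatz ::
    "real \<Rightarrow> real \<Rightarrow> (nat \<Rightarrow> complex) \<Rightarrow> nat \<Rightarrow> complex"
  where "wkb_ansatz \<gamma> \<rho> \<psi> n = of_real ((- \<gamma>) ^ n * real n powr (- \<rho>)) * exp (\<i> * \<psi> n)"

lemma wkb_ansatz_nonzero: "\<gamma> \<noteq> 0 \<Longrightarrow> n \<ge> 1 \<Longrightarrow> wkb_ansatz \<gamma> \<rho> \<psi> n \<noteq> 0"
  by (simp add: wkb_ansatz_def)

text \<open>
  This combination appears in the Wronskian of two terms of the form \<open>wkb_ansatz \<gamma> \<rho>\<close>: their
  powers and \<open>a n\<close> combine to \<open>n powr (\<sigma> - 2 * \<rho>)\<close>, the reciprocal of the order of the phase increment.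
\<close>

lemma power_weight_limit:
  assumes a: "(\<lambda>n. a n / real n powr \<sigma>) \<longlonglongrightarrow> 1"
  shows "(\<lambda>n. a n * real n powr (- \<rho>) * real (Suc n) powr (- \<rho>) * real n powr (2 * \<rho> - \<sigma>)) \<longlonglongrightarrow> 1"
proof -
  have "(\<lambda>n. (1 + 1 / real n) powr (- \<rho>)) \<longlonglongrightarrow> (1 + 0) powr (- \<rho>)"
    by (intro tendsto_intros lim_1_over_n) auto
  from tendsto_mult[OF a this] have "(\<lambda>n. a n / real n powr \<sigma> * (1 + 1 / real n) powr (- \<rho>)) \<longlonglongrightarrow> 1"
    by simp
  moreover have "\<forall>\<^sub>F n in sequentially. a n / real n powr \<sigma> * (1 + 1 / real n) powr (- \<rho>) =
      a n * real n powr (- \<rho>) * real (Suc n) powr (- \<rho>) * real n powr (2 * \<rho> - \<sigma>)"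
    using eventually_gt_at_top[of 0]
  proof eventually_elim
    case (elim n)
    have "real (Suc n) = real n * (1 + 1 / real n)"
      using elim by (simp add: field_simps)
    then have "real (Suc n) powr (- \<rho>) = real n powr (- \<rho>) * (1 + 1 / real n) powr (- \<rho>)"
      using elim by (simp only: powr_mult)
    moreover have "real n powr (2 * \<rho> - \<sigma>) = real n powr \<rho> * real n powr \<rho> / real n powr \<sigma>"
      using elim by (simp add: powr_diff powr_add[symmetric])
    moreover have "real n powr (- \<rho>) * real n powr \<rho> = 1"
      using elim by (simp add: powr_add[symmetric])
    ultimately show ?case
      by (simp add: field_simps powr_minus)
  qed
  ultimately show ?thesis by (simp add: filterlim_cong)
qed

lemma Suc_over_power_limit:
  assumes x: "(\<lambda>n. x n / of_real (real n powr s)) \<longlonglongrightarrow> (l::complex)"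
  shows "(\<lambda>n. x (Suc n) / of_real (real n powr s)) \<longlonglongrightarrow> l"
proof -
  have "(\<lambda>n. (1 + 1 / real n) powr s) \<longlonglongrightarrow> (1 + 0) powr s"
    by (intro tendsto_intros lim_1_over_n) auto
  then have "(\<lambda>n. complex_of_real ((1 + 1 / real n) powr s)) \<longlonglongrightarrow> of_real 1"
    by (intro tendsto_of_real) simp
  from tendsto_mult[OF LIMSEQ_Suc[OF x] this]
  have "(\<lambda>n. x (Suc n) / of_real (real (Suc n) powr s) * of_real ((1 + 1 / real n) powr s)) \<longlonglongrightarrow> l"
    by simp
  moreover have "\<forall>\<^sub>F n in sequentially.
      x (Suc n) / of_real (real (Suc n) powr s) * of_real ((1 + 1 / real n) powr s) =
      x (Suc n) / of_real (real n powr s)"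
    using eventually_gt_at_top[of 0]
  proof eventually_elim
    case (elim n)
    have "1 + 1 / real n = real (Suc n) / real n"
      using elim by (simp add: field_simps)
    then have "(1 + 1 / real n) powr s = real (Suc n) powr s / real n powr s"
      by (simp only: powr_divide)
    then show ?case using elim by simp
  qed
  ultimately show ?thesis by (simp add: filterlim_cong)
qed

text \<open>
  As \<open>x n\<close> may vanish, the Taylor remainder is estimated instead of the quotient \<open>(exp x - 1) / x\<close>.
\<close>

lemma exp_increment_limit:
  fixes x :: "nat \<Rightarrow> complex"
  assumes x: "x \<longlonglongrightarrow> 0" and xh: "(\<lambda>n. x n / h n) \<longlonglongrightarrow> l"
  shows "(\<lambda>n. (exp (x n) - 1) / h n) \<longlonglongrightarrow> l"
proof -
  have "(\<lambda>n. exp \<bar>Re (x n)\<bar> * norm (x n) * norm (x n / h n)) \<longlonglongrightarrow> exp \<bar>Re 0\<bar> * norm (0::complex) * norm l"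
    by (intro tendsto_intros x xh)
  then have lim: "(\<lambda>n. exp \<bar>Re (x n)\<bar> * norm (x n) * norm (x n / h n)) \<longlonglongrightarrow> 0"
    by simp
  have "(\<lambda>n. (exp (x n) - 1 - x n) / h n) \<longlonglongrightarrow> 0"
  proof (rule Lim_null_comparison[OF _ lim], intro always_eventually allI)
    fix n
    have "norm (exp (x n) - 1 - x n) \<le> exp \<bar>Re (x n)\<bar> * (norm (x n) * norm (x n))"
      using Taylor_exp[of "x n" 1] by (simp add: power2_eq_square numeral_2_eq_2 algebra_simps)
    then have "norm (exp (x n) - 1 - x n) / norm (h n) \<le>
        exp \<bar>Re (x n)\<bar> * (norm (x n) * norm (x n)) / norm (h n)"
      by (intro divide_right_mono) auto
    then show "norm ((exp (x n) - 1 - x n) / h n) \<le> exp \<bar>Re (x n)\<bar> * norm (x n) * norm (x n / h n)"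
      by (simp add: norm_divide)
  qed
  from tendsto_add[OF this xh] show ?thesis
    by (simp add: add_divide_distrib[symmetric])
qed

lemma upper_sqrt_scale:
  assumes r: "r > 0"
  shows "upper_sqrt (of_real r * t) = of_real (sqrt r) * upper_sqrt t"
proof -
  have "csqrt (of_real r * - t) = of_real (sqrt r) * csqrt (- t)"
  proof (rule csqrt_unique)
    show "(of_real (sqrt r) * csqrt (- t))\<^sup>2 = of_real r * - t"
      using r by (simp add: power_mult_distrib flip: of_real_power)
    show "0 < Re (of_real (sqrt r) * csqrt (- t)) \<or>
        Re (of_real (sqrt r) * csqrt (- t)) = 0 \<and> 0 \<le> Im (of_real (sqrt r) * csqrt (- t))"
      using csqrt_principal[of "- t"] r by (auto simp del: csqrt.sel)
  qed
  then show ?thesis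
    by (simp add: upper_sqrt_def)
qed

text \<open>
  Scaling by a positive number commutes with the branch, which reduces the claim to continuity of
  \<open>upper_sqrt\<close> at the point \<open>\<zeta>\<close> off the cut.
\<close>

lemma upper_sqrt_scaled_limit:
  assumes t: "(\<lambda>n. of_real (real n powr (2 * \<nu>)) * t n) \<longlonglongrightarrow> \<zeta>" and \<zeta>: "\<zeta> \<notin> nonneg_axis"
  shows "(\<lambda>n. upper_sqrt (t n) / of_real (real n powr (- \<nu>))) \<longlonglongrightarrow> upper_sqrt \<zeta>"
proof -
  have "isCont upper_sqrt \<zeta>"
    unfolding upper_sqrt_def
    by (intro continuous_intros isCont_csqrt' minus_notin_nonpos_Reals \<zeta>)
  from isCont_tendsto_compose[OF this t]
  have "(\<lambda>n. upper_sqrt (of_real (real n powr (2 * \<nu>)) * t n)) \<longlonglongrightarrow> upper_sqrt \<zeta>" .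
  moreover have "\<forall>\<^sub>F n in sequentially. upper_sqrt (of_real (real n powr (2 * \<nu>)) * t n) =
      upper_sqrt (t n) / of_real (real n powr (- \<nu>))"
    using eventually_gt_at_top[of 0]
  proof eventually_elim
    case (elim n)
    have "sqrt (real n powr (2 * \<nu>)) = real n powr \<nu>"
      by (rule real_sqrt_unique) (auto simp: power2_eq_square powr_add[symmetric])
    then show ?case
      using upper_sqrt_scale[of "real n powr (2 * \<nu>)" "t n"] elim by (simp add: powr_minus field_simps)
  qed
  ultimately show ?thesis by (simp add: filterlim_cong)
qed

lemma real_powr_to_0:
  assumes "s < 0"
  shows "(\<lambda>n. complex_of_real (real n powr s)) \<longlonglongrightarrow> 0"
  using tendsto_of_real[OF tendsto_neg_powr[OF assms filterlim_real_sequentially], where 'a = complex]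
  by simp

lemma tn_scaled_limit:
  assumes \<mu>: "0 < \<mu>" "\<mu> \<le> 1" "\<mu> \<le> \<sigma>" 
  shows "(\<lambda>n. of_real (real n powr \<mu>) * tn \<sigma> \<tau> n z) \<longlonglongrightarrow>
    (if \<mu> = \<sigma> then z else 0) - (if \<mu> = 1 then of_real \<tau> else 0)"
proof -
  have lim: "(\<lambda>n. complex_of_real (real n powr (\<mu> - s))) \<longlonglongrightarrow> (if \<mu> = s then 1 else 0)" if "\<mu> \<le> s" for s
  proof (cases "\<mu> = s")
    case True
    have "\<forall>\<^sub>F n in sequentially. complex_of_real (real n powr (\<mu> - s)) = 1"
      using eventually_gt_at_top[of 0] by eventually_elim (simp add: True)
    then show ?thesis using True by (simp add: tendsto_eventually)
  next
    case False
    then show ?thesis using real_powr_to_0[of "\<mu> - s"] that by simp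
  qed
  have "(\<lambda>n. z * of_real (real n powr (\<mu> - \<sigma>)) - of_real \<tau> * of_real (real n powr (\<mu> - 1))) \<longlonglongrightarrow>
      z * (if \<mu> = \<sigma> then 1 else 0) - of_real \<tau> * (if \<mu> = 1 then 1 else 0)"
    by (intro tendsto_intros lim \<mu>)
  moreover have "\<forall>\<^sub>F n in sequentially.
      z * of_real (real n powr (\<mu> - \<sigma>)) - of_real \<tau> * of_real (real n powr (\<mu> - 1)) =
      of_real (real n powr \<mu>) * tn \<sigma> \<tau> n z"
    using eventually_gt_at_top[of 0]
    by eventually_elim (simp add: tn_def powr_diff powr_minus field_simps)
  ultimately show ?thesis by (auto simp: filterlim_cong)
qed

text \<open>
  Each further term of \<open>Tn\<close> contains a factor \<open>tn\<close> more than the first one, and \<open>tn\<close> tends to 0.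
\<close>

lemma Tn_scaled_limit:
  assumes \<sigma>: "0 < \<sigma>" "\<sigma> < 1"
  shows "(\<lambda>n. of_real (real n powr \<sigma>) * Tn \<sigma> \<tau> L p n z) \<longlonglongrightarrow> z"
proof -
  have t: "(\<lambda>n. of_real (real n powr \<sigma>) * tn \<sigma> \<tau> n z) \<longlonglongrightarrow> z"
    using tn_scaled_limit[of \<sigma> \<sigma> \<tau> z] \<sigma> by simp
  have "(\<lambda>n. of_real (real n powr (- \<sigma>)) * (of_real (real n powr \<sigma>) * tn \<sigma> \<tau> n z)) \<longlonglongrightarrow> 0 * z"
    by (intro tendsto_mult t real_powr_to_0) (use \<sigma> in simp)
  moreover have "\<forall>\<^sub>F n in sequentially.
      of_real (real n powr (- \<sigma>)) * (of_real (real n powr \<sigma>) * tn \<sigma> \<tau> n z) = tn \<sigma> \<tau> n z"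
    using eventually_gt_at_top[of 0] by eventually_elim (simp add: powr_minus)
  ultimately have t0: "(\<lambda>n. tn \<sigma> \<tau> n z) \<longlonglongrightarrow> 0"
    by (simp add: filterlim_cong)
  have "(\<lambda>n. of_real (real n powr \<sigma>) * tn \<sigma> \<tau> n z + (\<Sum>l=2..L. of_real (p l) *
      (of_real (real n powr \<sigma>) * tn \<sigma> \<tau> n z) * tn \<sigma> \<tau> n z ^ (l - 1))) \<longlonglongrightarrow>
      z + (\<Sum>l=2..L. of_real (p l) * z * 0 ^ (l - 1))"
    by (intro tendsto_intros t t0)
  moreover have "(\<Sum>l=2..L. of_real (p l) * z * 0 ^ (l - 1)) = 0"
    by (intro sum.neutral) auto
  moreover have "of_real (real n powr \<sigma>) * tn \<sigma> \<tau> n z + (\<Sum>l=2..L. of_real (p l) *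
      (of_real (real n powr \<sigma>) * tn \<sigma> \<tau> n z) * tn \<sigma> \<tau> n z ^ (l - 1)) =
      of_real (real n powr \<sigma>) * Tn \<sigma> \<tau> L p n z" for n
  proof -
    have "(\<Sum>l=2..L. of_real (p l) * (of_real (real n powr \<sigma>) * tn \<sigma> \<tau> n z) * tn \<sigma> \<tau> n z ^ (l - 1)) =
        (\<Sum>l=2..L. of_real (real n powr \<sigma>) * (of_real (p l) * tn \<sigma> \<tau> n z ^ l))"
    proof (intro sum.cong refl)
      fix l assume "l \<in> {2..L}"
      then obtain j where "l = Suc j" by (cases l) auto
      then show "of_real (p l) * (of_real (real n powr \<sigma>) * tn \<sigma> \<tau> n z) * tn \<sigma> \<tau> n z ^ (l - 1) =
          of_real (real n powr \<sigma>) * (of_real (p l) * tn \<sigma> \<tau> n z ^ l)"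
        by simp
    qed
    then show ?thesis
      by (simp add: Tn_def distrib_left sum_distrib_left)
  qed
  ultimately show ?thesis by simp
qed

lemma of_real_in_nonneg_axis_iff: "of_real x \<in> nonneg_axis \<longleftrightarrow> 0 \<le> x"
  by (auto simp: nonneg_axis_def)

text \<open>
  The exponent \<open>2 * rho \<sigma> - \<sigma>\<close> is \<open>- 1/2\<close> for \<open>\<sigma> \<ge> 1\<close> and \<open>- \<sigma>/2\<close> for \<open>\<sigma> < 1\<close>. For \<open>\<sigma> > 1\<close> the
  limiting argument of the rescaled square root is \<open>- \<tau>\<close>, which is off the cut exactly when \<open>\<tau> > 0\<close>.
\<close>

lemma theta_leading_term_nonreal:
  assumes \<sigma>: "0 < \<sigma>"
    and off_cut: "if \<sigma> > 1 then \<tau> > 0 else if \<sigma> = 1 then \<zeta> - of_real \<tau> \<notin> nonneg_axis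
      else \<zeta> \<notin> nonneg_axis"
  shows "(\<lambda>n. theta \<sigma> \<tau> L p n \<zeta> / of_real (real n powr (2 * rho \<sigma> - \<sigma>))) \<longlonglongrightarrow> kappa \<sigma> \<tau> \<zeta>"
    and "Im (kappa \<sigma> \<tau> \<zeta>) > 0"
proof -
  consider "\<sigma> > 1" | "\<sigma> = 1" | "\<sigma> < 1" by linarith
  then have "(\<lambda>n. theta \<sigma> \<tau> L p n \<zeta> / of_real (real n powr (2 * rho \<sigma> - \<sigma>))) \<longlonglongrightarrow> kappa \<sigma> \<tau> \<zeta>
      \<and> Im (kappa \<sigma> \<tau> \<zeta>) > 0"
  proof cases
    case 1
    then have \<tau>: "\<tau> > 0" using off_cut by simp
    have "(\<lambda>n. upper_sqrt (tn \<sigma> \<tau> n \<zeta>) / of_real (real n powr (- (1 / 2))))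
        \<longlonglongrightarrow> upper_sqrt (- of_real \<tau>)"
      using tn_scaled_limit[of 1 \<sigma> \<tau> \<zeta>] 1 \<tau> of_real_in_nonneg_axis_iff[of "- \<tau>"]
      by (intro upper_sqrt_scaled_limit) auto
    then show ?thesis
      using 1 \<tau> by (simp add: theta_def kappa_def upper_sqrt_def rho_def csqrt_of_real)
  next
    case 2
    have "\<forall>\<^sub>F n in sequentially. upper_sqrt (\<zeta> - of_real \<tau>) =
        theta \<sigma> \<tau> L p n \<zeta> / of_real (real n powr (2 * rho \<sigma> - \<sigma>))"
      using eventually_gt_at_top[of 0] by eventually_elim (simp add: theta_def rho_def 2)
    then show ?thesis
      using 2 off_cut Im_upper_sqrt_pos[of "\<zeta> - of_real \<tau>"]
      by (auto simp: kappa_def intro!: tendsto_eventually elim!: eventually_mono)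
  next
    case 3
    have "(\<lambda>n. upper_sqrt (Tn \<sigma> \<tau> L p n \<zeta>) / of_real (real n powr (- (\<sigma> / 2)))) \<longlonglongrightarrow> upper_sqrt \<zeta>"
      using Tn_scaled_limit[of \<sigma> \<tau> L p \<zeta>] 3 \<sigma> off_cut by (intro upper_sqrt_scaled_limit) auto
    then show ?thesis
      using 3 off_cut Im_upper_sqrt_pos[of \<zeta>] by (simp add: theta_def kappa_def rho_def)
  qed
  then show "(\<lambda>n. theta \<sigma> \<tau> L p n \<zeta> / of_real (real n powr (2 * rho \<sigma> - \<sigma>))) \<longlonglongrightarrow> kappa \<sigma> \<tau> \<zeta>"
    and "Im (kappa \<sigma> \<tau> \<zeta>) > 0" by auto
qed

section \<open>Leading phase coefficient off the real axis\<close>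

text \<open>
  Constancy of the Wronskian gives a first order recursion for \<open>F n / f n\<close>. Dividing by
  \<open>exp (- 2 \<i> \<phi> n)\<close> turns it into \<open>x (n + 1) = exp (2 \<i> \<theta> (n + 1)) * x n + s n\<close>, where to
  leading order the factor is \<open>1 + 2 \<i> \<kappa> h n\<close> and \<open>s n\<close> is \<open>\<gamma> W h n\<close>, with
  \<open>h n = n powr (2 * \<rho> - \<sigma>)\<close>. As \<open>Im \<kappa> > 0\<close>, the recursion contracts towards its asymptotic fixed point
  \<open>\<gamma> W / (- 2 \<i> \<kappa>)\<close>. Leading order
  knowledge of \<open>\<theta>\<close> and \<open>f\<close> is enough because \<open>Im (\<theta> n)\<close> has the same order as \<open>\<theta> n\<close>.
\<close>

lemma asymptotics_nonreal_phase:
  fixes F f \<phi> \<theta> :: "nat \<Rightarrow> complex"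
  assumes \<gamma>: "\<gamma> \<in> {1, -1}"
    and a: "(\<lambda>n. a n / real n powr \<sigma>) \<longlonglongrightarrow> 1" and a_pos: "\<And>n. a n > 0"
    and F: "jacobi_solution a b z F" and f: "jacobi_solution a b z f"
    and f_asymp: "(\<lambda>n. f n / wkb_ansatz \<gamma> \<rho> \<phi> n) \<longlonglongrightarrow> 1"
    and \<phi>: "\<forall>\<^sub>F n in sequentially. \<phi> (Suc n) = \<phi> n + \<theta> (Suc n)"
    and \<nu>: "0 < \<sigma> - 2 * \<rho>" "\<sigma> - 2 * \<rho> \<le> 1"
    and \<theta>: "(\<lambda>n. \<theta> n / of_real (real n powr (2 * \<rho> - \<sigma>))) \<longlonglongrightarrow> \<kappa>" and \<kappa>: "Im \<kappa> > 0"
  shows "(\<lambda>n. F n / wkb_ansatz \<gamma> \<rho> (\<lambda>n. - \<phi> n) n) \<longlonglongrightarrow>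
    \<i> * of_real \<gamma> * wronskian a F f k / (2 * \<kappa>)"
proof -
  define W where "W = wronskian a F f k"
  define h where "h = (\<lambda>n. real n powr (2 * \<rho> - \<sigma>))"
  define x where "x = (\<lambda>n. F n / (f n * exp (- 2 * \<i> * \<phi> n)))"
  define s where "s = (\<lambda>n. - W * exp (2 * \<i> * \<phi> (Suc n)) / (of_real (a n) * f n * f (Suc n)))"
  define \<omega> where "\<omega> = (\<lambda>n. 1 - exp (2 * \<i> * \<theta> (Suc n)))"
  have \<gamma>2: "\<gamma> \<noteq> 0" "\<gamma> * \<gamma> = 1" using \<gamma> by auto
  define u where "u = (\<lambda>n. f n / wkb_ansatz \<gamma> \<rho> \<phi> n)"
  have u: "u \<longlonglongrightarrow> 1" unfolding u_def by (rule f_asymp)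
  have "\<forall>\<^sub>F n in sequentially. u n \<noteq> 0"
    using u by (rule tendsto_imp_eventually_ne) simp
  then have f0: "\<forall>\<^sub>F n in sequentially. f n \<noteq> 0"
    by eventually_elim (auto simp: u_def)
  then have f0': "\<forall>\<^sub>F n in sequentially. f (Suc n) \<noteq> 0"
    using eventually_sequentially_Suc[of "\<lambda>n. f n \<noteq> 0"] by simp
  have \<theta>_Suc: "(\<lambda>n. \<theta> (Suc n) / of_real (h n)) \<longlonglongrightarrow> \<kappa>"
    unfolding h_def by (rule Suc_over_power_limit[OF \<theta>])
  have h_lim: "h \<longlonglongrightarrow> 0"
    unfolding h_def using \<nu> tendsto_neg_powr[OF _ filterlim_real_sequentially, of "2 * \<rho> - \<sigma>"] by simp
  have h_pos: "\<forall>\<^sub>F n in sequentially. h n > 0"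
    using eventually_gt_at_top[of 0] by eventually_elim (simp add: h_def)
  have "(\<lambda>n. \<theta> (Suc n) / of_real (h n) * of_real (h n)) \<longlonglongrightarrow> \<kappa> * of_real 0"
    by (intro tendsto_intros \<theta>_Suc h_lim)
  moreover have "\<forall>\<^sub>F n in sequentially. \<theta> (Suc n) / of_real (h n) * of_real (h n) = \<theta> (Suc n)"
    using h_pos by eventually_elim simp
  ultimately have \<theta>0: "(\<lambda>n. \<theta> (Suc n)) \<longlonglongrightarrow> 0"
    by (simp add: filterlim_cong)
  have step: "\<forall>\<^sub>F n in sequentially. x (Suc n) = (1 - \<omega> n) * x n + s n"
    using f0 f0' \<phi>
  proof eventually_elim
    case (elim n)
    have "W = of_real (a n) * (F n * f (Suc n) - F (Suc n) * f n)"
      using wronskian_constant[OF F f, of n k] by (simp add: W_def wronskian_def)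
    then have quotient: "F (Suc n) / f (Suc n) = F n / f n - W / (of_real (a n) * f n * f (Suc n))"
      using elim a_pos[of n] by (simp add: field_simps)
    have E: "exp (2 * \<i> * \<theta> (Suc n)) * exp (2 * \<i> * \<phi> n) = exp (2 * \<i> * \<phi> (Suc n))"
      using elim by (simp add: exp_add[symmetric] algebra_simps)
    have x_eq: "x m = F m / f m * exp (2 * \<i> * \<phi> m)" for m
      by (simp add: x_def exp_minus field_simps)
    have "x (Suc n) = F n / f n * exp (2 * \<i> * \<phi> (Suc n)) + s n"
      unfolding x_eq quotient by (simp add: s_def algebra_simps)
    also have "F n / f n * exp (2 * \<i> * \<phi> (Suc n)) = (1 - \<omega> n) * x n"
      unfolding x_eq \<omega>_def E[symmetric] by simp
    finally show ?case .
  qed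
  have \<omega>_lim: "(\<lambda>n. \<omega> n / of_real (h n)) \<longlonglongrightarrow> - (2 * \<i> * \<kappa>)"
  proof -
    have "(\<lambda>n. (exp (2 * \<i> * \<theta> (Suc n)) - 1) / of_real (h n)) \<longlonglongrightarrow> 2 * \<i> * \<kappa>"
    proof (rule exp_increment_limit)
      show "(\<lambda>n. 2 * \<i> * \<theta> (Suc n)) \<longlonglongrightarrow> 0"
        using tendsto_mult[OF tendsto_const \<theta>0, of "2 * \<i>"] by simp
      show "(\<lambda>n. 2 * \<i> * \<theta> (Suc n) / of_real (h n)) \<longlonglongrightarrow> 2 * \<i> * \<kappa>"
        using tendsto_mult[OF tendsto_const \<theta>_Suc, of "2 * \<i>"] by simp
    qed
    from tendsto_minus[OF this] show ?thesis
      unfolding \<omega>_def by (simp add: minus_divide_left)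
  qed
  have s_lim: "(\<lambda>n. s n / of_real (h n)) \<longlonglongrightarrow> of_real \<gamma> * W"
  proof -
    define r where "r = (\<lambda>n. a n * real n powr (- \<rho>) * real (Suc n) powr (- \<rho>) * h n)"
    have r: "r \<longlonglongrightarrow> 1"
      unfolding r_def h_def by (rule power_weight_limit[OF a])
    have "(\<lambda>n. of_real \<gamma> * W * exp (\<i> * \<theta> (Suc n)) / (of_real (r n) * u n * u (Suc n))) \<longlonglongrightarrow>
        of_real \<gamma> * W * exp (\<i> * 0) / (of_real 1 * 1 * 1)"
      by (intro tendsto_intros \<theta>0 r u LIMSEQ_Suc[OF u]) simp
    moreover have "\<forall>\<^sub>F n in sequentially. of_real \<gamma> * W * exp (\<i> * \<theta> (Suc n)) /
        (of_real (r n) * u n * u (Suc n)) = s n / of_real (h n)"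
      using \<phi> eventually_gt_at_top[of 0]
    proof eventually_elim
      case (elim n)
      define E where "E = exp (\<i> * \<phi> n)"
      define D where "D = exp (\<i> * \<theta> (Suc n))"
      define g where "g = complex_of_real ((- \<gamma>) ^ n)"
      have gg: "g * g = 1"
        using \<gamma> by (auto simp: g_def simp flip: power_mult_distrib)
      have E': "exp (\<i> * \<phi> (Suc n)) = E * D"
        using elim by (simp add: E_def D_def exp_add[symmetric] algebra_simps)
      have E2: "exp (2 * \<i> * \<phi> (Suc n)) = (E * D) * (E * D)"
        unfolding E'[symmetric] by (simp add: exp_add[symmetric] algebra_simps)
      define q where "q = complex_of_real (real n powr (- \<rho>))"
      define q' where "q' = complex_of_real (real (Suc n) powr (- \<rho>))"
      have nz: "E \<noteq> 0" "D \<noteq> 0" "g \<noteq> 0" "q \<noteq> 0" "q' \<noteq> 0"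
        using elim gg by (auto simp: E_def D_def q_def q'_def)
      have fn: "f n = u n * (g * q * E)"
        using nz by (simp add: u_def wkb_ansatz_def g_def q_def E_def)
      have fn': "f (Suc n) = u (Suc n) * (- of_real \<gamma> * g * q' * (E * D))"
        using nz \<gamma>2 by (simp add: u_def wkb_ansatz_def g_def q'_def E'[symmetric])
      have rn: "of_real (r n) = of_real (a n) * q * q' * of_real (h n)"
        by (simp add: r_def q_def q'_def)
      have "s n / of_real (h n) = - W * ((E * D) * (E * D)) /
          (of_real (a n) * (u n * (g * q * E)) * (u (Suc n) * (- of_real \<gamma> * g * q' * (E * D))) * of_real (h n))"
        unfolding s_def E2 fn fn' by simp
      also have "\<dots> = W * ((E * D) * (E * D)) /
          ((g * g) * of_real \<gamma> * (of_real (a n) * q * q' * of_real (h n)) * u n * u (Suc n) * (E * (E * D)))"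
        by (simp add: mult_ac)
      also have "\<dots> = W * D / (of_real \<gamma> * of_real (r n) * u n * u (Suc n))"
        unfolding gg rn[symmetric] using nz by (simp add: field_simps)
      also have "\<dots> = of_real \<gamma> * W * D / (of_real (r n) * u n * u (Suc n))"
        using \<gamma> by auto
      finally show ?case by (simp add: D_def)
    qed
    ultimately show ?thesis by (simp add: filterlim_cong)
  qed
  have x_lim: "x \<longlonglongrightarrow> of_real \<gamma> * W / (- (2 * \<i> * \<kappa>))"
  proof (rule complex_recursion_limit[OF step \<omega>_lim s_lim])
    show "\<not> summable h"
      using \<nu> by (simp add: h_def summable_real_powr_iff)
    show "h \<longlonglongrightarrow> 0" "\<forall>\<^sub>F n in sequentially. h n > 0" by fact+
  qed (use \<kappa> in \<open>auto simp: h_def\<close>)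
  have "(\<lambda>n. x n * u n) \<longlonglongrightarrow> of_real \<gamma> * W / (- (2 * \<i> * \<kappa>)) * 1"
    by (intro tendsto_mult x_lim u)
  moreover have "\<forall>\<^sub>F n in sequentially. x n * u n = F n / wkb_ansatz \<gamma> \<rho> (\<lambda>n. - \<phi> n) n"
    using f0 eventually_gt_at_top[of 0]
  proof eventually_elim
    case (elim n)
    have "exp (- (\<i> * \<phi> n)) = exp (- 2 * \<i> * \<phi> n) * exp (\<i> * \<phi> n)"
      by (simp add: exp_add[symmetric])
    then show ?case
      using elim by (simp add: x_def u_def wkb_ansatz_def)
  qed
  moreover have "of_real \<gamma> * W / (- (2 * \<i> * \<kappa>)) * 1 = \<i> * of_real \<gamma> * W / (2 * \<kappa>)"
  proof (cases "\<kappa> = 0")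
    case False
    have "of_real \<gamma> * W / (- (2 * \<i> * \<kappa>)) = (\<i> * \<i>) * of_real \<gamma> * W / (2 * \<i> * \<kappa>)"
      by simp
    also have "\<dots> = \<i> * of_real \<gamma> * W / (2 * \<kappa>)"
      using False by (simp add: field_simps)
    finally show ?thesis by simp
  qed simp
  ultimately show ?thesis
    unfolding W_def by (simp add: filterlim_cong)
qed

section \<open>Asymptotic expansions in powers of the index\<close>

text \<open>
  The two signs serve the ratios of \<open>n + 1\<close> and \<open>n - 1\<close> to \<open>n\<close>.
\<close>

lemma powr_first_order:
  fixes c s :: real
  assumes c: "c = 1 \<or> c = -1"
  shows "(\<lambda>n. (1 + c / real n) powr s - (1 + s * c / real n)) \<in> O(\<lambda>n. 1 / real n ^ 2)"
proof -
  define y where "y = (\<lambda>n. s * ln (1 + c / real n))"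
  have "(\<lambda>n. ln (1 + c / real n) - c / real n) \<in> O(\<lambda>n. 1 / real n ^ 2)"
    using c by (elim disjE; simp only:; real_asymp)
  then have "(\<lambda>n. s * (ln (1 + c / real n) - c / real n)) \<in> O(\<lambda>n. 1 / real n ^ 2)"
    by simp
  then have y: "(\<lambda>n. y n - s * c / real n) \<in> O(\<lambda>n. 1 / real n ^ 2)"
    by (simp add: y_def algebra_simps)
  have "(\<lambda>n. ln (1 + c / real n)) \<in> O(\<lambda>n. 1 / real n)"
    using c by (elim disjE; simp only:; real_asymp)
  then have y1: "y \<in> O(\<lambda>n. 1 / real n)"
    by (simp add: y_def)
  have "(\<lambda>n. 1 / real n) \<in> O(\<lambda>n. 1::real)"
    by real_asymp
  from landau_o.big_trans[OF y1 this]
  obtain k where bounded: "\<forall>\<^sub>F n in sequentially. norm (y n) \<le> k"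
    by (auto elim!: landau_o.bigE)
  have "(\<lambda>n. exp (y n) - 1 - y n) \<in> O(\<lambda>n. y n ^ 2)"
  proof (rule bigoI)
    show "\<forall>\<^sub>F n in sequentially. norm (exp (y n) - 1 - y n) \<le> exp k * norm (y n ^ 2)"
      using bounded
    proof eventually_elim
      case (elim n)
      have "norm (exp (y n) - 1 - y n) \<le> exp (norm (y n)) * norm (y n ^ 2)"
        using Taylor_exp_field[of "y n" 1] by (simp add: power2_eq_square numeral_2_eq_2 algebra_simps)
      also have "\<dots> \<le> exp k * norm (y n ^ 2)"
        using elim by (intro mult_right_mono) auto
      finally show ?case .
    qed
  qed
  also have "(\<lambda>n. y n ^ 2) \<in> O(\<lambda>n. (1 / real n) ^ 2)"
    by (rule landau_o.big_power[OF y1])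
  finally have "(\<lambda>n. exp (y n) - 1 - y n) \<in> O(\<lambda>n. 1 / real n ^ 2)"
    by (simp add: power_divide)
  from sum_in_bigo(1)[OF this y] show ?thesis
  proof (rule landau_o.big.in_cong[THEN iffD1, rotated])
    show "\<forall>\<^sub>F n in sequentially. exp (y n) - 1 - y n + (y n - s * c / real n) =
        (1 + c / real n) powr s - (1 + s * c / real n)"
      using eventually_gt_at_top[of 1]
    proof eventually_elim
      case (elim n)
      then have "1 + c / real n \<noteq> 0" using c by (auto simp: field_simps)
      then show ?case by (simp add: powr_def y_def)
    qed
  qed
qed

lemma first_order_mult:
  fixes f g :: "nat \<Rightarrow> real"
  assumes f: "(\<lambda>n. f n - (1 + p / real n)) \<in> O(\<lambda>n. 1 / real n ^ 2)"
    and g: "(\<lambda>n. g n - (1 + q / real n)) \<in> O(\<lambda>n. 1 / real n ^ 2)"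
  shows "(\<lambda>n. f n * g n - (1 + (p + q) / real n)) \<in> O(\<lambda>n. 1 / real n ^ 2)"
proof -
  have bounded: "(\<lambda>n. 1 + c / real n) \<in> O(\<lambda>n. 1)" for c
    by real_asymp
  have small: "(\<lambda>n. 1 / real n ^ 2) \<in> O(\<lambda>n. 1)"
    by real_asymp
  have "(\<lambda>n. (g n - (1 + q / real n)) + (1 + q / real n)) \<in> O(\<lambda>n. 1)"
    by (intro sum_in_bigo bounded landau_o.big_trans[OF g small])
  then have g_bounded: "g \<in> O(\<lambda>n. 1)" by simp
  have "(\<lambda>n. (f n - (1 + p / real n)) * g n + (1 + p / real n) * (g n - (1 + q / real n))
      + p * q * (1 / real n ^ 2)) \<in> O(\<lambda>n. 1 / real n ^ 2)"
  proof (intro sum_in_bigo)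
    show "(\<lambda>n. p * q * (1 / real n ^ 2)) \<in> O(\<lambda>n. 1 / real n ^ 2)"
      by (rule bigoI[of _ "\<bar>p * q\<bar>"]) (simp add: abs_mult)
  qed (use landau_o.big.mult[OF f g_bounded] landau_o.big.mult[OF bounded[of p] g] in auto)
  moreover have "(f n - (1 + p / real n)) * g n + (1 + p / real n) * (g n - (1 + q / real n))
      + p * q * (1 / real n ^ 2) = f n * g n - (1 + (p + q) / real n)" for n
    by (simp add: algebra_simps power2_eq_square add_divide_distrib)
  ultimately show ?thesis by simp
qed

lemma first_order_pred:
  fixes f :: "nat \<Rightarrow> real"
  assumes f: "(\<lambda>n. f n - (1 + p / real n)) \<in> O(\<lambda>n. 1 / real n ^ 2)"
  shows "(\<lambda>n. f (n - 1) - (1 + p / real n)) \<in> O(\<lambda>n. 1 / real n ^ 2)"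
proof -
  have pred: "\<forall>\<^sub>F n in sequentially. real (n - 1) = real n - 1"
    using eventually_gt_at_top[of 0] by eventually_elim auto
  have "(\<lambda>n. f (n - 1) - (1 + p / real (n - 1))) \<in> O(\<lambda>n. 1 / real (n - 1) ^ 2)"
    by (rule landau_o.big.compose[OF f filterlim_minus_const_nat_at_top])
  also have "(\<lambda>n. 1 / real (n - 1) ^ 2) \<in> \<Theta>(\<lambda>n. 1 / (real n - 1) ^ 2)"
    by (rule bigthetaI_cong) (use pred in \<open>eventually_elim, simp\<close>)
  also have "(\<lambda>n. 1 / (real n - 1) ^ 2) \<in> O(\<lambda>n. 1 / real n ^ 2)"
    by real_asymp
  finally have 1: "(\<lambda>n. f (n - 1) - (1 + p / real (n - 1))) \<in> O(\<lambda>n. 1 / real n ^ 2)" .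
  have "(\<lambda>n. 1 / (real n - 1) - 1 / real n) \<in> O(\<lambda>n. 1 / real n ^ 2)"
    by real_asymp
  then have "(\<lambda>n. p * (1 / (real n - 1) - 1 / real n)) \<in> O(\<lambda>n. 1 / real n ^ 2)"
    by simp
  from sum_in_bigo(1)[OF 1 this] show ?thesis
  proof (rule landau_o.big.in_cong[THEN iffD1, rotated])
    show "\<forall>\<^sub>F n in sequentially. f (n - 1) - (1 + p / real (n - 1)) +
        p * (1 / (real n - 1) - 1 / real n) = f (n - 1) - (1 + p / real n)"
      using pred by eventually_elim (simp add: algebra_simps)
  qed
qed

text \<open>
  Powers of the index as complex numbers: a Landau class consists of functions with the same
  codomain as its bound, and most of the expansions below are complex.
\<close>

definition npow :: "real \<Rightarrow> nat \<Rightarrow> complex"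
  where "npow s n = of_real (real n powr s)"

lemma npow_mult_npow: "npow s n * npow t n = npow (s + t) n"
  by (simp add: npow_def powr_add)

lemma npow_bigo_mono:
  assumes "f \<in> O(npow s)" "s \<le> t"
  shows "f \<in> O(npow t)"
proof (rule landau_o.big_trans[OF assms(1)])
  show "npow s \<in> O(npow t)"
  proof (rule bigoI[of _ 1])
    show "\<forall>\<^sub>F n in sequentially. norm (npow s n) \<le> 1 * norm (npow t n)"
      using eventually_gt_at_top[of 0]
      by eventually_elim (use assms(2) in \<open>simp add: npow_def powr_mono\<close>)
  qed
qed

lemma npow_bigo_mult:
  assumes "f \<in> O(npow s)" "g \<in> O(npow t)" "s + t \<le> r"
  shows "(\<lambda>n. f n * g n) \<in> O(npow r)"
proof (rule npow_bigo_mono[OF _ assms(3)])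
  show "(\<lambda>n. f n * g n) \<in> O(npow (s + t))"
    using landau_o.big.mult[OF assms(1,2)] by (simp add: npow_mult_npow)
qed

lemma of_real_bigo_npow:
  assumes "x \<in> O(\<lambda>n. 1 / real n ^ 2)"
  shows "(\<lambda>n. complex_of_real (x n)) \<in> O(npow (- 2))"
proof -
  obtain c where c: "\<forall>\<^sub>F n in sequentially. norm (x n) \<le> c * norm (1 / real n ^ 2)"
    using landau_o.bigE[OF assms] by blast
  have "\<forall>\<^sub>F n in sequentially. norm (complex_of_real (x n)) \<le> c * norm (npow (- 2) n)"
    using c eventually_gt_at_top[of 0]
  proof eventually_elim
    case (elim n)
    have "real n powr (- 2) = 1 / real n ^ 2"
      using elim by (simp add: powr_minus powr_numeral divide_inverse)
    with elim show ?case
      unfolding npow_def norm_of_real by simp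
  qed
  then show ?thesis by (rule bigoI)
qed

lemma npow_bigo_of_limit:
  assumes "(\<lambda>n. x n / npow s n) \<longlonglongrightarrow> l"
  shows "x \<in> O(npow s)"
proof (rule bigoI_tendsto[OF assms])
  show "\<forall>\<^sub>F n in sequentially. npow s n \<noteq> 0"
    using eventually_gt_at_top[of 0] by eventually_elim (simp add: npow_def)
qed

text \<open>
  For \<open>s\<close> of order \<open>n powr (- 1/2)\<close> the cubic term has order \<open>n powr (- 3/2)\<close>, which is too large to be
  an error term; it has to be kept until it cancels between the two neighbours.
\<close>

lemma exp_third_order:
  assumes s: "s \<in> O(npow (- 1 / 2))"
  shows "(\<lambda>n. exp (\<i> * s n) - (1 + \<i> * s n - (s n)\<^sup>2 / 2 - \<i> * s n ^ 3 / 6)) \<in> O(npow (- 2))"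
proof -
  have "s \<in> O(npow 0)"
    by (rule npow_bigo_mono[OF s]) simp
  then obtain c where "\<forall>\<^sub>F n in sequentially. norm (s n) \<le> c * norm (npow 0 n)"
    using landau_o.bigE by blast
  then have c: "\<forall>\<^sub>F n in sequentially. norm (s n) \<le> c"
    using eventually_gt_at_top[of 0] by eventually_elim (simp add: npow_def)
  have "(\<lambda>n. s n ^ 4) \<in> O(\<lambda>n. npow (- 1 / 2) n ^ 4)"
    by (rule landau_o.big_power[OF s])
  also have "(\<lambda>n. npow (- 1 / 2) n ^ 4) = npow (- 2)"
    by (simp add: fun_eq_iff power4_eq_xxxx npow_mult_npow)
  finally have s4: "(\<lambda>n. s n ^ 4) \<in> O(npow (- 2))" .
  have "(\<lambda>n. exp (\<i> * s n) - (1 + \<i> * s n - (s n)\<^sup>2 / 2 - \<i> * s n ^ 3 / 6)) \<in> O(\<lambda>n. s n ^ 4)"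
  proof (rule bigoI)
    show "\<forall>\<^sub>F n in sequentially. norm (exp (\<i> * s n) -
        (1 + \<i> * s n - (s n)\<^sup>2 / 2 - \<i> * s n ^ 3 / 6)) \<le> exp c * norm (s n ^ 4)"
      using c
    proof eventually_elim
      case (elim n)
      have poly: "(\<Sum>k\<le>3. (\<i> * s n) ^ k / fact k) =
          1 + \<i> * s n - (s n)\<^sup>2 / 2 - \<i> * s n ^ 3 / 6"
      proof -
        have "(\<Sum>k\<le>3. g k) = g 0 + g 1 + g 2 + g 3" for g :: "nat \<Rightarrow> complex"
          by (simp add: eval_nat_numeral)
        moreover have "\<i> ^ 3 = - \<i>"
          by (simp add: power3_eq_cube)
        moreover have "fact 2 = (2::complex)" "fact 3 = (6::complex)"
          by (simp_all add: fact_numeral)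
        ultimately show ?thesis
          by (simp add: power_mult_distrib)
      qed
      have "norm (exp (\<i> * s n) - (\<Sum>k\<le>3. (\<i> * s n) ^ k / fact k)) \<le>
          exp \<bar>Re (\<i> * s n)\<bar> * norm (\<i> * s n) ^ Suc 3 / fact 3"
        by (rule Taylor_exp)
      also have "\<dots> \<le> exp c * norm (s n) ^ 4 / 1"
      proof (intro frac_le mult_mono)
        show "exp \<bar>Re (\<i> * s n)\<bar> \<le> exp c"
          using abs_Im_le_cmod[of "s n"] elim by simp
        show "norm (\<i> * s n) ^ Suc 3 \<le> norm (s n) ^ 4"
          by (simp add: norm_mult eval_nat_numeral)
        show "(1::real) \<le> fact 3"
          by (rule fact_ge_1)
      qed auto
      finally show ?case
        unfolding poly by (simp add: norm_power)
    qed
  qed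
  from landau_o.big_trans[OF this s4] show ?thesis .
qed

lemma npow_increment:
  "(\<lambda>n. npow (- \<mu>) (Suc n) - npow (- \<mu>) n + of_real \<mu> * npow (- \<mu> - 1) n) \<in> O(npow (- \<mu> - 2))"
proof -
  have "(\<lambda>n. npow (- \<mu>) n * of_real ((1 + 1 / real n) powr (- \<mu>) - (1 + (- \<mu>) * 1 / real n)))
      \<in> O(npow (- \<mu> - 2))"
    using npow_bigo_mult[OF landau_o.big_refl of_real_bigo_npow[OF powr_first_order[of 1 "- \<mu>"]]]
    by simp
  then show ?thesis
  proof (rule landau_o.big.in_cong[THEN iffD1, rotated])
    show "\<forall>\<^sub>F n in sequentially.
        npow (- \<mu>) n * of_real ((1 + 1 / real n) powr (- \<mu>) - (1 + (- \<mu>) * 1 / real n)) =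
        npow (- \<mu>) (Suc n) - npow (- \<mu>) n + of_real \<mu> * npow (- \<mu> - 1) n"
      using eventually_gt_at_top[of 0]
    proof eventually_elim
      case (elim n)
      have "real (Suc n) = real n * (1 + 1 / real n)"
        using elim by (simp add: field_simps)
      then have 1: "real (Suc n) powr (- \<mu>) = real n powr (- \<mu>) * (1 + 1 / real n) powr (- \<mu>)"
        using elim by (simp only: powr_mult)
      have 2: "real n powr (- \<mu> - 1) = real n powr (- \<mu>) / real n"
        using elim by (simp add: powr_diff)
      show ?case
        unfolding npow_def 1 2 by (simp add: algebra_simps)
    qed
  qed
qed

text \<open>
  The increment of \<open>s\<close> is the increment of \<open>s\<^sup>2\<close> divided by \<open>s (n + 1) + s n\<close>. The square behaves like
  \<open>c / n\<close>, with increment \<open>- s\<^sup>2 / n\<close> up to order \<open>n powr (- 1 - \<sigma>)\<close> (the term in \<open>\<zeta>\<close> has another exponent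
  and does not fit exactly); hence \<open>s\<close> has increment \<open>- s / (2 n)\<close> up to order \<open>n powr (- 1/2 - \<sigma>)\<close>.
\<close>

lemma sqrt_phase_increments:
  fixes s :: "nat \<Rightarrow> complex"
  assumes s: "(\<lambda>n. s n / npow (- 1 / 2) n) \<longlonglongrightarrow> \<kappa>" and \<kappa>: "\<kappa> \<noteq> 0"
    and sq: "\<forall>\<^sub>F n in sequentially. (s n)\<^sup>2 = c * npow (- 1) n + \<zeta> * npow (- \<sigma>) n"
    and \<sigma>: "1 < \<sigma>" "\<sigma> \<le> 3 / 2"
  shows "(\<lambda>n. s (Suc n) - s n + s n * npow (- 1) n / 2) \<in> O(npow (- 1 / 2 - \<sigma>))"
    and "(\<lambda>n. (s (Suc n))\<^sup>2 - (s n)\<^sup>2) \<in> O(npow (- 2))"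
    and "(\<lambda>n. s (Suc n) ^ 3 - s n ^ 3) \<in> O(npow (- 2))"
proof -
  define S where "S = (\<lambda>n. s (Suc n) + s n)"
  define D where "D = (\<lambda>n. (s (Suc n))\<^sup>2 - (s n)\<^sup>2)"
  have s_bigo: "s \<in> O(npow (- 1 / 2))"
    by (rule npow_bigo_of_limit[OF s])
  have s': "(\<lambda>n. s (Suc n) / npow (- 1 / 2) n) \<longlonglongrightarrow> \<kappa>"
    using Suc_over_power_limit[of s "- 1 / 2" \<kappa>] s unfolding npow_def by simp
  have s'_bigo: "(\<lambda>n. s (Suc n)) \<in> O(npow (- 1 / 2))"
    by (rule npow_bigo_of_limit[OF s'])
  have S_lim: "(\<lambda>n. S n / npow (- 1 / 2) n) \<longlonglongrightarrow> \<kappa> + \<kappa>"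
    using tendsto_add[OF s' s] by (simp add: S_def add_divide_distrib)
  have S0: "\<forall>\<^sub>F n in sequentially. S n \<noteq> 0"
    using tendsto_imp_eventually_ne[OF S_lim, of 0] \<kappa> by (auto elim: eventually_mono)
  have inv_S: "(\<lambda>n. inverse (S n)) \<in> O(npow (1 / 2))"
  proof (rule npow_bigo_of_limit)
    have "(\<lambda>n. inverse (S n / npow (- 1 / 2) n)) \<longlonglongrightarrow> inverse (\<kappa> + \<kappa>)"
      using \<kappa> by (intro tendsto_inverse S_lim) simp
    moreover have "inverse (S n / npow (- 1 / 2) n) = inverse (S n) / npow (1 / 2) n" for n
      by (simp add: npow_def powr_minus field_simps)
    ultimately show "(\<lambda>n. inverse (S n) / npow (1 / 2) n) \<longlonglongrightarrow> inverse (\<kappa> + \<kappa>)"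
      by simp
  qed
  have D_expansion: "(\<lambda>n. D n + (s n)\<^sup>2 * npow (- 1) n) \<in> O(npow (- 1 - \<sigma>))"
  proof -
    have "(\<lambda>n. c * (npow (- 1) (Suc n) - npow (- 1) n + of_real 1 * npow (- 1 - 1) n)
        + \<zeta> * (npow (- \<sigma>) (Suc n) - npow (- \<sigma>) n + of_real \<sigma> * npow (- \<sigma> - 1) n)
        + \<zeta> * (1 - of_real \<sigma>) * npow (- \<sigma> - 1) n) \<in> O(npow (- 1 - \<sigma>))"
    proof (intro sum_in_bigo)
      have cm: "(\<lambda>n. k * g n) \<in> O(npow (- 1 - \<sigma>))" if "g \<in> O(npow r)" "r \<le> - 1 - \<sigma>" for k g r
        using npow_bigo_mono[OF that] by simp
      show "(\<lambda>n. c * (npow (- 1) (Suc n) - npow (- 1) n + of_real 1 * npow (- 1 - 1) n)) \<in> O(npow (- 1 - \<sigma>))"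
        by (rule cm[OF npow_increment[of 1]]) (use \<sigma> in simp)
      show "(\<lambda>n. \<zeta> * (npow (- \<sigma>) (Suc n) - npow (- \<sigma>) n + of_real \<sigma> * npow (- \<sigma> - 1) n))
          \<in> O(npow (- 1 - \<sigma>))"
        by (rule cm[OF npow_increment[of \<sigma>]]) simp
      show "(\<lambda>n. \<zeta> * (1 - of_real \<sigma>) * npow (- \<sigma> - 1) n) \<in> O(npow (- 1 - \<sigma>))"
        by (rule cm[OF landau_o.big_refl]) simp
    qed
    then show ?thesis
    proof (rule landau_o.big.in_cong[THEN iffD1, rotated])
      have sq': "\<forall>\<^sub>F n in sequentially.
          (s (Suc n))\<^sup>2 = c * npow (- 1) (Suc n) + \<zeta> * npow (- \<sigma>) (Suc n)"
        using sq eventually_sequentially_Suc[of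
            "\<lambda>n. (s n)\<^sup>2 = c * npow (- 1) n + \<zeta> * npow (- \<sigma>) n"] by simp
      show "\<forall>\<^sub>F n in sequentially.
          c * (npow (- 1) (Suc n) - npow (- 1) n + of_real 1 * npow (- 1 - 1) n)
          + \<zeta> * (npow (- \<sigma>) (Suc n) - npow (- \<sigma>) n + of_real \<sigma> * npow (- \<sigma> - 1) n)
          + \<zeta> * (1 - of_real \<sigma>) * npow (- \<sigma> - 1) n = D n + (s n)\<^sup>2 * npow (- 1) n"
        using sq sq'
      proof eventually_elim
        case (elim n)
        have p: "npow (- 1 - 1) n = npow (- 1) n * npow (- 1) n"
            "npow (- \<sigma> - 1) n = npow (- \<sigma>) n * npow (- 1) n"
          by (simp_all add: npow_mult_npow)
        show ?case
          unfolding D_def elim p by (simp add: algebra_simps)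
      qed
    qed
  qed
  have s2: "(\<lambda>n. (s n)\<^sup>2) \<in> O(npow (- 1))"
    unfolding power2_eq_square by (rule npow_bigo_mult[OF s_bigo s_bigo]) simp
  have s2n: "(\<lambda>n. (s n)\<^sup>2 * npow (- 1) n) \<in> O(npow (- 2))"
    by (rule npow_bigo_mult[OF s2 landau_o.big_refl]) simp
  have D_bigo: "D \<in> O(npow (- 2))"
    using sum_in_bigo(2)[OF npow_bigo_mono[OF D_expansion] s2n] \<sigma> by simp
  then show "(\<lambda>n. (s (Suc n))\<^sup>2 - (s n)\<^sup>2) \<in> O(npow (- 2))"
    unfolding D_def .
  have D_factor: "D n = (s (Suc n) - s n) * S n" for n
    by (simp add: D_def S_def power2_eq_square algebra_simps)
  have inc: "(\<lambda>n. s (Suc n) - s n) \<in> O(npow (- 3 / 2))"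
  proof -
    have "(\<lambda>n. D n * inverse (S n)) \<in> O(npow (- 3 / 2))"
      by (rule npow_bigo_mult[OF D_bigo inv_S]) simp
    then show ?thesis
      by (rule landau_o.big.in_cong[THEN iffD1, rotated])
        (use S0 in \<open>eventually_elim, simp add: D_factor\<close>)
  qed
  have "(\<lambda>n. s (Suc n) * D n + (s n)\<^sup>2 * (s (Suc n) - s n)) \<in> O(npow (- 2))"
    using npow_bigo_mult[OF s'_bigo D_bigo] npow_bigo_mult[OF s2 inc]
    by (intro sum_in_bigo) auto
  moreover have "s (Suc n) * D n + (s n)\<^sup>2 * (s (Suc n) - s n) = s (Suc n) ^ 3 - s n ^ 3" for n
    by (simp add: D_def power2_eq_square power3_eq_cube algebra_simps)
  ultimately show "(\<lambda>n. s (Suc n) ^ 3 - s n ^ 3) \<in> O(npow (- 2))"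
    by simp
  have "(\<lambda>n. s n * npow (- 1) n * (s (Suc n) - s n) / 2) \<in> O(npow (- 1 - \<sigma>))"
    using npow_bigo_mult[OF npow_bigo_mult[OF s_bigo landau_o.big_refl order_refl] inc,
        of "- 1" "- 1 - \<sigma>"] \<sigma> by simp
  from sum_in_bigo(1)[OF D_expansion this]
  have "(\<lambda>n. (D n + (s n)\<^sup>2 * npow (- 1) n + s n * npow (- 1) n * (s (Suc n) - s n) / 2) * inverse (S n))
      \<in> O(npow (- 1 / 2 - \<sigma>))"
    by (rule npow_bigo_mult[OF _ inv_S]) simp
  then show "(\<lambda>n. s (Suc n) - s n + s n * npow (- 1) n / 2) \<in> O(npow (- 1 / 2 - \<sigma>))"
  proof (rule landau_o.big.in_cong[THEN iffD1, rotated])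
    show "\<forall>\<^sub>F n in sequentially.
        (D n + (s n)\<^sup>2 * npow (- 1) n + s n * npow (- 1) n * (s (Suc n) - s n) / 2) * inverse (S n) =
        s (Suc n) - s n + s n * npow (- 1) n / 2"
      using S0
    proof eventually_elim
      case (elim n)
      have "D n + (s n)\<^sup>2 * npow (- 1) n + s n * npow (- 1) n * (s (Suc n) - s n) / 2 =
          (s (Suc n) - s n + s n * npow (- 1) n / 2) * S n"
        unfolding D_factor by (simp add: S_def power2_eq_square field_simps)
      then show ?case using elim by simp
    qed
  qed
qed

text \<open>
  The two exponentials are expanded to third order. Terms independent of \<open>s\<close> cancel by
  \<open>k1 + k2 = 2 \<beta> - \<tau>\<close> and by the equation for \<open>s\<^sup>2\<close>; the linear terms leave \<open>\<i> (s (n + 1) - s n)\<close>, close to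
  \<open>- \<i> s / (2 n)\<close>, against \<open>\<i> (k2 - k1) s / n\<close>, which is why \<open>k2 - k1\<close> has to be \<open>1/2\<close>; the cubic
  terms of the two neighbours have opposite signs.
\<close>

lemma three_term_cancellation:
  fixes s c1 c2 :: "nat \<Rightarrow> complex" and k1 k2 \<beta> \<tau> \<zeta> :: complex
  assumes s: "(\<lambda>n. s n / npow (- 1 / 2) n) \<longlonglongrightarrow> \<kappa>" and \<kappa>: "\<kappa> \<noteq> 0"
    and sq: "\<forall>\<^sub>F n in sequentially. (s n)\<^sup>2 = - \<tau> * npow (- 1) n + \<zeta> * npow (- \<sigma>) n"
    and \<sigma>: "1 < \<sigma>" "\<sigma> \<le> 3 / 2"
    and c1: "(\<lambda>n. c1 n - (1 + k1 * npow (- 1) n)) \<in> O(npow (- 2))"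
    and c2: "(\<lambda>n. c2 n - (1 + k2 * npow (- 1) n)) \<in> O(npow (- 2))"
    and k: "k2 = k1 + 1 / 2" "k1 + k2 = 2 * \<beta> - \<tau>"
  shows "(\<lambda>n. c1 n * exp (- (\<i> * s n)) + c2 n * exp (\<i> * s (Suc n))
      - 2 - 2 * \<beta> * npow (- 1) n + \<zeta> * npow (- \<sigma>) n) \<in> O(npow (- 1 / 2 - \<sigma>))"
proof -
  define r where "r = - 1 / 2 - \<sigma>"
  have r: "- 2 \<le> r" using \<sigma> by (simp add: r_def)
  have s_bigo: "s \<in> O(npow (- 1 / 2))"
    by (rule npow_bigo_of_limit[OF s])
  have s': "(\<lambda>n. s (Suc n) / npow (- 1 / 2) n) \<longlonglongrightarrow> \<kappa>"
    using Suc_over_power_limit[of s "- 1 / 2" \<kappa>] s unfolding npow_def by simp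
  have s'_bigo: "(\<lambda>n. s (Suc n)) \<in> O(npow (- 1 / 2))"
    by (rule npow_bigo_of_limit[OF s'])
  define e1 where "e1 = (\<lambda>n. exp (- (\<i> * s n)))"
  define e2 where "e2 = (\<lambda>n. exp (\<i> * s (Suc n)))"
  define p1 where "p1 = (\<lambda>n. 1 - \<i> * s n - (s n)\<^sup>2 / 2 + \<i> * s n ^ 3 / 6)"
  define p2 where "p2 = (\<lambda>n. 1 + \<i> * s (Suc n) - (s (Suc n))\<^sup>2 / 2 - \<i> * s (Suc n) ^ 3 / 6)"
  have e1: "(\<lambda>n. e1 n - p1 n) \<in> O(npow (- 2))"
    using exp_third_order[of "\<lambda>n. - s n"] s_bigo by (simp add: e1_def p1_def)
  have e2: "(\<lambda>n. e2 n - p2 n) \<in> O(npow (- 2))"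
    using exp_third_order[OF s'_bigo] by (simp add: e2_def p2_def)
  have const: "(\<lambda>n. k) \<in> O(npow 0)" for k :: complex
  proof (rule bigoI[of _ "norm k"])
    show "\<forall>\<^sub>F n in sequentially. norm k \<le> norm k * norm (npow 0 n)"
      using eventually_gt_at_top[of 0] by eventually_elim (simp add: npow_def)
  qed
  have exp_bounded: "(\<lambda>n. exp (u n)) \<in> O(npow 0)" if "u \<longlonglongrightarrow> 0" for u :: "nat \<Rightarrow> complex"
  proof -
    have "(\<lambda>n. exp (u n) / npow 0 n) \<longlonglongrightarrow> exp 0"
    proof (rule Lim_transform_eventually)
      show "(\<lambda>n. exp (u n)) \<longlonglongrightarrow> exp 0"
        by (intro tendsto_intros that)
      show "\<forall>\<^sub>F n in sequentially. exp (u n) = exp (u n) / npow 0 n"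
        using eventually_gt_at_top[of 0] by eventually_elim (simp add: npow_def)
    qed
    then show ?thesis by (rule npow_bigo_of_limit)
  qed
  have null: "u \<longlonglongrightarrow> 0" if "(\<lambda>n. u n / npow (- 1 / 2) n) \<longlonglongrightarrow> \<kappa>" for u
  proof -
    have "(\<lambda>n. u n / npow (- 1 / 2) n * npow (- 1 / 2) n) \<longlonglongrightarrow> \<kappa> * 0"
      using real_powr_to_0[of "- 1 / 2"]
      by (intro tendsto_mult that) (simp add: npow_def[abs_def])
    moreover have "\<forall>\<^sub>F n in sequentially. u n / npow (- 1 / 2) n * npow (- 1 / 2) n = u n"
      using eventually_gt_at_top[of 0] by eventually_elim (simp add: npow_def)
    ultimately show ?thesis by (simp add: filterlim_cong)
  qed
  have e1_bounded: "e1 \<in> O(npow 0)"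
    unfolding e1_def using tendsto_mult[OF tendsto_const null[OF s], of "- \<i>"]
    by (intro exp_bounded) simp
  have e2_bounded: "e2 \<in> O(npow 0)"
    unfolding e2_def using tendsto_mult[OF tendsto_const null[OF s'], of "\<i>"]
    by (intro exp_bounded) simp
  \<comment> \<open>The polynomial \<open>p2\<close> in \<open>s (n + 1)\<close> is re-expanded around \<open>s n\<close>: \<open>R1\<close>, \<open>R2\<close>, \<open>R3\<close> are the
    errors made by this, and \<open>Q\<close> collects what carries an additional factor \<open>1 / n\<close>.\<close>
  define R1 where "R1 = (\<lambda>n. s (Suc n) - s n + s n * npow (- 1) n / 2)"
  define R2 where "R2 = (\<lambda>n. (s (Suc n))\<^sup>2 - (s n)\<^sup>2)"
  define R3 where "R3 = (\<lambda>n. s (Suc n) ^ 3 - s n ^ 3)"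
  have R1: "R1 \<in> O(npow r)"
    unfolding R1_def r_def using sqrt_phase_increments(1)[OF s \<kappa> sq \<sigma>] .
  have R2: "R2 \<in> O(npow (- 2))" and R3: "R3 \<in> O(npow (- 2))"
    unfolding R2_def R3_def using sqrt_phase_increments(2,3)[OF s \<kappa> sq \<sigma>] .
  have s2: "(\<lambda>n. (s n)\<^sup>2) \<in> O(npow (- 1))"
    unfolding power2_eq_square by (rule npow_bigo_mult[OF s_bigo s_bigo]) simp
  have s3: "(\<lambda>n. s n ^ 3) \<in> O(npow (- 1))"
    unfolding power3_eq_cube
    by (rule npow_bigo_mult[OF npow_bigo_mult[OF s_bigo s_bigo order_refl] s_bigo]) simp
  have sn: "(\<lambda>n. s n * npow (- 1) n) \<in> O(npow (- 1))"
    by (rule npow_bigo_mult[OF s_bigo landau_o.big_refl]) simp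
  have lead: "(\<lambda>n. 1 + k * npow (- 1) n) \<in> O(npow 0)" for k
    using const[of 1] npow_bigo_mult[OF const[of k] landau_o.big_refl, of "- 1" 0]
    by (intro sum_in_bigo) auto
  have weaken: "g \<in> O(npow r)" if "g \<in> O(npow (- 2))" for g
    using that r by (rule npow_bigo_mono)
  define Q where "Q = (\<lambda>n. k1 * (- (s n)\<^sup>2 / 2 + \<i> * s n ^ 3 / 6)
      + k2 * (- \<i> * (s n * npow (- 1) n) / 2 + \<i> * R1 n - (s n)\<^sup>2 / 2 - R2 n / 2
              - \<i> * s n ^ 3 / 6 - \<i> * R3 n / 6))"
  have Q: "Q \<in> O(npow (- 1))"
  proof -
    have cm: "(\<lambda>n. k * g n / m) \<in> O(npow (- 1))" if "g \<in> O(npow t)" "t \<le> - 1" for k m g t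
      using npow_bigo_mono[OF that] by (simp add: divide_inverse)
    have "(\<lambda>n. - k1 * (s n)\<^sup>2 / 2 + k1 * \<i> * s n ^ 3 / 6
      + - k2 * \<i> * (s n * npow (- 1) n) / 2 + k2 * \<i> * R1 n / 1 + - k2 * (s n)\<^sup>2 / 2 + - k2 * R2 n / 2
      + - k2 * \<i> * s n ^ 3 / 6 + - k2 * \<i> * R3 n / 6) \<in> O(npow (- 1))"
      by (intro sum_in_bigo cm[OF s2] cm[OF s3] cm[OF sn] cm[OF R1] cm[OF R2] cm[OF R3])
        (use \<sigma> in \<open>auto simp: r_def\<close>)
    then show ?thesis by (simp add: Q_def algebra_simps)
  qed
  have total: "(\<lambda>n. (c1 n - (1 + k1 * npow (- 1) n)) * e1 n + (1 + k1 * npow (- 1) n) * (e1 n - p1 n)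
      + (c2 n - (1 + k2 * npow (- 1) n)) * e2 n + (1 + k2 * npow (- 1) n) * (e2 n - p2 n)
      + \<i> * R1 n - R2 n / 2 - \<i> / 6 * R3 n + npow (- 1) n * Q n) \<in> O(npow r)"
  proof (intro sum_in_bigo)
    show "(\<lambda>n. (c1 n - (1 + k1 * npow (- 1) n)) * e1 n) \<in> O(npow r)"
      by (rule npow_bigo_mult[OF c1 e1_bounded]) (use r in simp)
    show "(\<lambda>n. (c2 n - (1 + k2 * npow (- 1) n)) * e2 n) \<in> O(npow r)"
      by (rule npow_bigo_mult[OF c2 e2_bounded]) (use r in simp)
    show "(\<lambda>n. (1 + k1 * npow (- 1) n) * (e1 n - p1 n)) \<in> O(npow r)"
      by (rule npow_bigo_mult[OF lead e1]) (use r in simp)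
    show "(\<lambda>n. (1 + k2 * npow (- 1) n) * (e2 n - p2 n)) \<in> O(npow r)"
      by (rule npow_bigo_mult[OF lead e2]) (use r in simp)
    show "(\<lambda>n. npow (- 1) n * Q n) \<in> O(npow r)"
      by (rule npow_bigo_mult[OF landau_o.big_refl Q]) (use r in simp)
  qed (use R1 weaken[OF R2] weaken[OF R3] in auto)
  show ?thesis
    unfolding r_def[symmetric]
  proof (rule landau_o.big.in_cong[THEN iffD1, OF _ total])
    show "\<forall>\<^sub>F n in sequentially.
        (c1 n - (1 + k1 * npow (- 1) n)) * e1 n + (1 + k1 * npow (- 1) n) * (e1 n - p1 n)
        + (c2 n - (1 + k2 * npow (- 1) n)) * e2 n + (1 + k2 * npow (- 1) n) * (e2 n - p2 n)
        + \<i> * R1 n - R2 n / 2 - \<i> / 6 * R3 n + npow (- 1) n * Q n =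
        c1 n * exp (- (\<i> * s n)) + c2 n * exp (\<i> * s (Suc n))
        - 2 - 2 * \<beta> * npow (- 1) n + \<zeta> * npow (- \<sigma>) n"
      using sq
    proof eventually_elim
      case (elim n)
      define u where "u = npow (- 1) n"
      define v where "v = s (Suc n)"
      have Z: "\<zeta> * npow (- \<sigma>) n = (s n)\<^sup>2 + \<tau> * u"
        using elim by (simp add: u_def)
      have \<tau>: "\<tau> = 2 * \<beta> - 2 * k1 - 1 / 2"
        using k by (simp add: algebra_simps)
      have exps: "exp (- (\<i> * s n)) = e1 n" "exp (\<i> * v) = e2 n"
        by (simp_all add: e1_def e2_def v_def)
      show ?case
        unfolding exps Z Q_def R1_def R2_def R3_def p1_def p2_def
          u_def[symmetric] v_def[symmetric] k(1) \<tau>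
        by (simp add: field_simps power2_eq_square power3_eq_cube)
    qed
  qed
qed

section \<open>Residual of the ansatz\<close>

text \<open>
  This ratio and the next one remove the sign \<open>(- \<gamma>) ^ n\<close> and the exponentials of the accumulated
  phase from the residual, which leaves the increments of the phase.
\<close>

lemma wkb_ansatz_Suc_ratio:
  assumes \<gamma>: "\<gamma> \<in> {1, -1}" and n: "n \<ge> 1" and step: "\<psi> (Suc n) = \<psi> n + s"
  shows "wkb_ansatz \<gamma> \<rho> \<psi> (Suc n) =
    - of_real \<gamma> * of_real ((1 + 1 / real n) powr (- \<rho>)) * exp (\<i> * s) * wkb_ansatz \<gamma> \<rho> \<psi> n"
proof -
  have "real (Suc n) = real n * (1 + 1 / real n)"
    using n by (simp add: field_simps)
  then have "real (Suc n) powr (- \<rho>) = real n powr (- \<rho>) * (1 + 1 / real n) powr (- \<rho>)"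
    by (simp only: powr_mult)
  moreover have "exp (\<i> * \<psi> (Suc n)) = exp (\<i> * \<psi> n) * exp (\<i> * s)"
    by (simp add: step exp_add[symmetric] algebra_simps)
  ultimately show ?thesis
    unfolding wkb_ansatz_def by simp
qed

lemma wkb_ansatz_pred_ratio:
  assumes \<gamma>: "\<gamma> \<in> {1, -1}" and n: "n \<ge> 1" and step: "\<psi> (Suc n) = \<psi> n + s"
  shows "wkb_ansatz \<gamma> \<rho> \<psi> n =
    - of_real \<gamma> * of_real ((1 + (- 1) / real (Suc n)) powr (- \<rho>)) * exp (- (\<i> * s))
      * wkb_ansatz \<gamma> \<rho> \<psi> (Suc n)"
proof -
  have "real n = real (Suc n) * (1 + (- 1) / real (Suc n))"
    by (simp add: field_simps)
  then have "real n powr (- \<rho>) = real (Suc n) powr (- \<rho>) * (1 + (- 1) / real (Suc n)) powr (- \<rho>)"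
    using powr_mult[of "real (Suc n)" "1 + (- 1) / real (Suc n)" "- \<rho>"] by simp
  moreover have "exp (\<i> * \<psi> n) = exp (\<i> * \<psi> (Suc n)) * exp (- (\<i> * s))"
    by (simp add: step exp_add[symmetric] algebra_simps)
  moreover have "(- \<gamma>) ^ n = - \<gamma> * (- \<gamma>) ^ Suc n"
    using \<gamma> by auto
  ultimately show ?thesis
    unfolding wkb_ansatz_def by (simp only: of_real_mult of_real_minus) (simp add: mult_ac)
qed

text \<open>
  With \<open>k1 = \<alpha> - \<sigma> + \<rho>\<close> and \<open>k2 = \<alpha> - \<rho>\<close> as first order coefficients of the neighbours, the
  cancellation applies: \<open>\<rho> = \<sigma>/2 - 1/4\<close> is the value with \<open>k2 - k1 = 1/2\<close>, and \<open>\<tau>\<close> is defined to be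
  \<open>2 \<beta> - k1 - k2\<close>. The bound \<open>n powr (- 1/2 - \<sigma>)\<close> for the remainder is multiplied by \<open>n powr \<sigma>\<close>.
\<close>

lemma relative_residual_bigo:
  assumes \<gamma>: "\<gamma> \<in> {1, -1}" and \<sigma>: "1 < \<sigma>" "\<sigma> \<le> 3 / 2"
    and a: "(\<lambda>n. a n / real n powr \<sigma> - (1 + \<alpha> / real n)) \<in> O(\<lambda>n. 1 / real n ^ 2)"
    and b: "(\<lambda>n. b n / (2 * \<gamma> * real n powr \<sigma>) - (1 + \<beta> / real n)) \<in> O(\<lambda>n. 1 / real n ^ 2)"
    and \<tau>: "\<tau> = 2 * \<beta> - 2 * \<alpha> + \<sigma>" and \<rho>: "\<rho> = \<sigma> / 2 - 1 / 4"
    and \<psi>: "\<forall>\<^sub>F n in sequentially. \<psi> (Suc n) = \<psi> n + s (Suc n)"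
    and s: "(\<lambda>n. s n / npow (- 1 / 2) n) \<longlonglongrightarrow> \<kappa>" and \<kappa>: "\<kappa> \<noteq> 0"
    and sq: "\<forall>\<^sub>F n in sequentially. (s n)\<^sup>2 = tn \<sigma> \<tau> n (of_real \<gamma> * z)"
  shows "(\<lambda>n. residual a b z (wkb_ansatz \<gamma> \<rho> \<psi>) n / wkb_ansatz \<gamma> \<rho> \<psi> n) \<in> O(npow (- 1 / 2))"
proof -
  define \<zeta> where "\<zeta> = of_real \<gamma> * z"
  define x where "x = (\<lambda>n. a n / real n powr \<sigma>)"
  define c1 where "c1 = (\<lambda>n. x (n - 1) * (1 + (- 1) / real n) powr (\<sigma> - \<rho>))"
  define c2 where "c2 = (\<lambda>n. x n * (1 + 1 / real n) powr (- \<rho>))"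
  define y where "y = (\<lambda>n. b n / (2 * \<gamma> * real n powr \<sigma>) - (1 + \<beta> / real n))"
  have cast: "(\<lambda>n. complex_of_real (c n) - (1 + of_real k * npow (- 1) n)) \<in> O(npow (- 2))"
    if "(\<lambda>n. c n - (1 + k / real n)) \<in> O(\<lambda>n. 1 / real n ^ 2)" for c k
    using of_real_bigo_npow[OF that] by (simp add: npow_def powr_minus divide_inverse)
  have c1: "(\<lambda>n. complex_of_real (c1 n) - (1 + of_real (\<alpha> + (\<sigma> - \<rho>) * (- 1)) * npow (- 1) n)) \<in> O(npow (- 2))"
    unfolding c1_def x_def
    by (intro cast first_order_mult first_order_pred[OF a] powr_first_order) simp
  have c2: "(\<lambda>n. complex_of_real (c2 n) - (1 + of_real (\<alpha> + (- \<rho>) * 1) * npow (- 1) n)) \<in> O(npow (- 2))"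
    unfolding c2_def x_def
    by (intro cast first_order_mult a powr_first_order) simp
  have sq': "\<forall>\<^sub>F n in sequentially. (s n)\<^sup>2 = - of_real \<tau> * npow (- 1) n + \<zeta> * npow (- \<sigma>) n"
    using sq by eventually_elim (simp add: tn_def npow_def \<zeta>_def powr_minus divide_inverse)
  have E: "(\<lambda>n. of_real (c1 n) * exp (- (\<i> * s n)) + of_real (c2 n) * exp (\<i> * s (Suc n))
      - 2 - 2 * of_real \<beta> * npow (- 1) n + \<zeta> * npow (- \<sigma>) n) \<in> O(npow (- 1 / 2 - \<sigma>))"
  proof (rule three_term_cancellation[OF s \<kappa> sq' \<sigma> c1 c2])
    have "\<alpha> + (- \<rho>) * 1 = \<alpha> + (\<sigma> - \<rho>) * (- 1) + 1 / 2"
      unfolding \<rho> by (simp add: field_simps)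
    from arg_cong[OF this, of complex_of_real]
    show "complex_of_real (\<alpha> + (- \<rho>) * 1) = of_real (\<alpha> + (\<sigma> - \<rho>) * (- 1)) + 1 / 2"
      by simp
    have "\<alpha> + (\<sigma> - \<rho>) * (- 1) + (\<alpha> + (- \<rho>) * 1) = 2 * \<beta> - \<tau>"
      unfolding \<tau> by (simp add: field_simps)
    from arg_cong[OF this, of complex_of_real]
    show "complex_of_real (\<alpha> + (\<sigma> - \<rho>) * (- 1)) + of_real (\<alpha> + (- \<rho>) * 1) =
        2 * of_real \<beta> - of_real \<tau>"
      by simp
  qed
  have y: "(\<lambda>n. 2 * complex_of_real (y n)) \<in> O(npow (- 1 / 2 - \<sigma>))"
  proof -
    have "(\<lambda>n. complex_of_real (y n)) \<in> O(npow (- 1 / 2 - \<sigma>))"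
      unfolding y_def by (rule npow_bigo_mono[OF of_real_bigo_npow[OF b]]) (use \<sigma> in simp)
    then show ?thesis by simp
  qed
  have total: "(\<lambda>n. - of_real \<gamma> * (npow \<sigma> n * (of_real (c1 n) * exp (- (\<i> * s n)) + of_real (c2 n) * exp (\<i> * s (Suc n))
      - 2 - 2 * of_real \<beta> * npow (- 1) n + \<zeta> * npow (- \<sigma>) n - 2 * of_real (y n)))) \<in> O(npow (- 1 / 2))"
    using npow_bigo_mult[OF landau_o.big_refl sum_in_bigo(2)[OF E y], of \<sigma> "- 1 / 2"] by simp
  have \<psi>_pred: "\<forall>\<^sub>F n in sequentially. \<psi> n = \<psi> (n - 1) + s n"
    using \<psi> eventually_sequentially_Suc[of "\<lambda>n. \<psi> n = \<psi> (n - 1) + s n"] by simp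
  show ?thesis
  proof (rule landau_o.big.in_cong[THEN iffD1, OF _ total])
    show "\<forall>\<^sub>F n in sequentially. - of_real \<gamma> * (npow \<sigma> n * (of_real (c1 n) * exp (- (\<i> * s n))
        + of_real (c2 n) * exp (\<i> * s (Suc n))
        - 2 - 2 * of_real \<beta> * npow (- 1) n + \<zeta> * npow (- \<sigma>) n - 2 * of_real (y n))) =
        residual a b z (wkb_ansatz \<gamma> \<rho> \<psi>) n / wkb_ansatz \<gamma> \<rho> \<psi> n"
      using \<psi> \<psi>_pred eventually_ge_at_top[of 2]
    proof eventually_elim
      case (elim n)
      define X where "X = wkb_ansatz \<gamma> \<rho> \<psi> n"
      define P where "P = real n powr \<sigma>"
      have P: "P > 0" using elim by (simp add: P_def)
      have X: "X \<noteq> 0"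
        unfolding X_def using \<gamma> elim by (intro wkb_ansatz_nonzero) auto
      have gg: "of_real \<gamma> * of_real \<gamma> = (1::complex)" using \<gamma> by auto
      have Xs: "wkb_ansatz \<gamma> \<rho> \<psi> (n + 1) =
          - of_real \<gamma> * of_real ((1 + 1 / real n) powr (- \<rho>)) * exp (\<i> * s (Suc n)) * X"
        unfolding X_def Suc_eq_plus1[symmetric] using elim
        by (intro wkb_ansatz_Suc_ratio[OF \<gamma>]) auto
      have Xp: "wkb_ansatz \<gamma> \<rho> \<psi> (n - 1) =
          - of_real \<gamma> * of_real ((1 + (- 1) / real n) powr (- \<rho>)) * exp (- (\<i> * s n)) * X"
        using wkb_ansatz_pred_ratio[OF \<gamma>, of "n - 1" \<psi> "s n" \<rho>] elim by (simp add: X_def)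
      have a2: "a n * (1 + 1 / real n) powr (- \<rho>) = P * c2 n"
        using P by (simp add: c2_def x_def P_def)
      have a1: "a (n - 1) * (1 + (- 1) / real n) powr (- \<rho>) = P * c1 n"
      proof -
        have "real (n - 1) = real n * (1 + (- 1) / real n)"
          using elim by (simp add: field_simps)
        then have 1: "real (n - 1) powr \<sigma> = P * (1 + (- 1) / real n) powr \<sigma>"
          unfolding P_def by (simp only: powr_mult)
        have q: "0 < 1 + (- 1) / real n" using elim by (simp add: field_simps)
        have "(1 + (- 1) / real n) powr (\<sigma> - \<rho>) =
            (1 + (- 1) / real n) powr \<sigma> * (1 + (- 1) / real n) powr (- \<rho>)"
          by (simp add: powr_add[symmetric])
        then show ?thesis
          unfolding c1_def x_def 1 using P q by simp
      qed
      have b1: "complex_of_real (b n) = of_real P * (2 * of_real \<gamma> * (1 + of_real \<beta> * npow (- 1) n + of_real (y n)))"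
      proof -
        have "1 + \<beta> * real n powr (- 1) + y n = b n / (2 * \<gamma> * P)"
          by (simp add: y_def P_def powr_minus_divide)
        then have "b n = P * (2 * \<gamma> * (1 + \<beta> * real n powr (- 1) + y n))"
          using \<gamma> P by auto
        then show ?thesis
          unfolding npow_def
          by (simp only: of_real_mult of_real_add of_real_numeral of_real_1)
      qed
      have zz: "z = of_real P * (of_real \<gamma> * \<zeta> * npow (- \<sigma>) n)"
      proof -
        have "of_real P * npow (- \<sigma>) n = 1"
          using P by (simp add: P_def npow_def powr_minus)
        then have "of_real P * (of_real \<gamma> * \<zeta> * npow (- \<sigma>) n) = of_real \<gamma> * \<zeta>"
          by (simp add: mult_ac)
        then show ?thesis using gg by (simp add: \<zeta>_def mult.assoc[symmetric])
      qed
      have "residual a b z (wkb_ansatz \<gamma> \<rho> \<psi>) n =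
          (- of_real \<gamma> * of_real (a (n - 1) * (1 + (- 1) / real n) powr (- \<rho>)) * exp (- (\<i> * s n))
          + (of_real (b n) - z)
          - of_real \<gamma> * of_real (a n * (1 + 1 / real n) powr (- \<rho>)) * exp (\<i> * s (Suc n))) * X"
        unfolding residual_def Xs Xp by (simp add: X_def[symmetric] algebra_simps)
      then have 1: "residual a b z (wkb_ansatz \<gamma> \<rho> \<psi>) n / X =
          - of_real \<gamma> * of_real (P * c1 n) * exp (- (\<i> * s n))
          + (of_real (b n) - z) - of_real \<gamma> * of_real (P * c2 n) * exp (\<i> * s (Suc n))"
        unfolding a1 a2 using X by simp
      have "of_real (b n) - z = - of_real \<gamma> * (of_real P * (- 2 - 2 * of_real \<beta> * npow (- 1) n
          + \<zeta> * npow (- \<sigma>) n - 2 * of_real (y n)))"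
        by (subst b1, subst zz) (simp add: algebra_simps)
      then show ?case
        unfolding X_def[symmetric] 1 by (simp add: npow_def P_def[symmetric] algebra_simps)
    qed
  qed
qed

section \<open>Real leading phase coefficient\<close>

lemma exp_twice_phase_to_0:
  fixes \<phi> \<theta> :: "nat \<Rightarrow> complex"
  assumes \<phi>: "\<forall>\<^sub>F n in sequentially. \<phi> (Suc n) = \<phi> n + \<theta> (Suc n)"
    and Im: "\<forall>\<^sub>F n in sequentially. 0 \<le> Im (\<theta> n)"
    and div: "\<not> summable (\<lambda>n. Im (\<theta> n))"
  shows "(\<lambda>n. exp (2 * \<i> * \<phi> n)) \<longlonglongrightarrow> 0"
proof -
  have "\<forall>\<^sub>F n in sequentially. \<phi> (Suc n) = \<phi> n + \<theta> (Suc n) \<and> 0 \<le> Im (\<theta> n)"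
    using \<phi> Im by (rule eventually_conj)
  then obtain k where k: "\<And>n. n \<ge> k \<Longrightarrow> \<phi> (Suc n) = \<phi> n + \<theta> (Suc n) \<and> 0 \<le> Im (\<theta> n)"
    unfolding eventually_sequentially by blast
  have sum: "Im (\<phi> (n + k)) = Im (\<phi> k) + (\<Sum>m<n. Im (\<theta> (m + Suc k)))" for n
    by (induction n) (use k in auto)
  have "filterlim (\<lambda>n. \<Sum>m<n. Im (\<theta> (m + Suc k))) at_top sequentially"
  proof (rule filterlim_sum_at_top_if_not_summable)
    show "\<not> summable (\<lambda>m. Im (\<theta> (m + Suc k)))"
      using div by (subst summable_iff_shift)
    show "0 \<le> Im (\<theta> (m + Suc k))" for m
      using k[of "m + Suc k"] by simp
  qed
  from filterlim_tendsto_add_at_top[OF tendsto_const this, of "Im (\<phi> k)"]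
  have "filterlim (\<lambda>n. Im (\<phi> (n + k))) at_top sequentially"
    by (simp only: sum)
  from filterlim_tendsto_pos_mult_at_top[OF tendsto_const _ this, of 2]
  have "filterlim (\<lambda>n. 2 * Im (\<phi> (n + k))) at_top sequentially"
    by simp
  then have "(\<lambda>n. exp (- (2 * Im (\<phi> (n + k))))) \<longlonglongrightarrow> 0"
    by (intro filterlim_compose[OF exp_at_bot] filterlim_compose[OF filterlim_uminus_at_bot_at_top])
  then have "(\<lambda>n. norm (exp (2 * \<i> * \<phi> (n + k)))) \<longlonglongrightarrow> 0"
    by simp
  then have "(\<lambda>n. exp (2 * \<i> * \<phi> (n + k))) \<longlonglongrightarrow> 0"
    by (rule tendsto_norm_zero_cancel)
  then show ?thesis by (rule LIMSEQ_offset)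
qed

text \<open>
  The accumulated phases cancel in the products, so the Wronskian is
  \<open>- \<gamma> * (exp (\<i> \<theta>) - exp (- \<i> \<theta>)) \<approx> - 2 \<i> \<gamma> \<theta>\<close>, with \<open>\<theta> = \<theta> (n + 1)\<close>, times the weight of
  \<open>power_weight_limit\<close>.
\<close>

lemma wkb_ansatz_wronskian_limit:
  assumes \<gamma>: "\<gamma> \<in> {1, -1}" and a: "(\<lambda>n. a n / real n powr \<sigma>) \<longlonglongrightarrow> 1"
    and \<nu>: "2 * \<rho> < \<sigma>"
    and \<phi>: "\<forall>\<^sub>F n in sequentially. \<phi> (Suc n) = \<phi> n + \<theta> (Suc n)"
    and \<theta>: "(\<lambda>n. \<theta> n / of_real (real n powr (2 * \<rho> - \<sigma>))) \<longlonglongrightarrow> \<kappa>"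
  shows "wronskian a (wkb_ansatz \<gamma> \<rho> (\<lambda>n. - \<phi> n)) (wkb_ansatz \<gamma> \<rho> \<phi>) \<longlonglongrightarrow> - 2 * \<i> * of_real \<gamma> * \<kappa>"
proof -
  define h where "h = (\<lambda>n. real n powr (2 * \<rho> - \<sigma>))"
  define r where "r = (\<lambda>n. a n * real n powr (- \<rho>) * real (Suc n) powr (- \<rho>) * h n)"
  have r: "r \<longlonglongrightarrow> 1"
    unfolding r_def h_def by (rule power_weight_limit[OF a])
  have \<theta>_Suc: "(\<lambda>n. \<theta> (Suc n) / of_real (h n)) \<longlonglongrightarrow> \<kappa>"
    unfolding h_def by (rule Suc_over_power_limit[OF \<theta>])
  have h0: "(\<lambda>n. complex_of_real (h n)) \<longlonglongrightarrow> 0"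
    unfolding h_def using \<nu> by (intro real_powr_to_0) simp
  have h_pos: "\<forall>\<^sub>F n in sequentially. h n > 0"
    using eventually_gt_at_top[of 0] by eventually_elim (simp add: h_def)
  have "(\<lambda>n. \<theta> (Suc n) / of_real (h n) * of_real (h n)) \<longlonglongrightarrow> \<kappa> * 0"
    by (intro tendsto_intros \<theta>_Suc h0)
  moreover have "\<forall>\<^sub>F n in sequentially. \<theta> (Suc n) / of_real (h n) * of_real (h n) = \<theta> (Suc n)"
    using h_pos by eventually_elim simp
  ultimately have \<theta>0: "(\<lambda>n. \<theta> (Suc n)) \<longlonglongrightarrow> 0"
    by (simp add: filterlim_cong)
  have exp_lim: "(\<lambda>n. (exp (c * \<theta> (Suc n)) - 1) / of_real (h n)) \<longlonglongrightarrow> c * \<kappa>" for c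
    using tendsto_mult[OF tendsto_const \<theta>0, of c] tendsto_mult[OF tendsto_const \<theta>_Suc, of c]
    by (intro exp_increment_limit) simp_all
  have "(\<lambda>n. - of_real \<gamma> * of_real (r n) * ((exp (\<i> * \<theta> (Suc n)) - 1) / of_real (h n)
      - (exp (- \<i> * \<theta> (Suc n)) - 1) / of_real (h n))) \<longlonglongrightarrow> - of_real \<gamma> * of_real 1 * (\<i> * \<kappa> - (- \<i>) * \<kappa>)"
    by (intro tendsto_intros r exp_lim)
  moreover have "\<forall>\<^sub>F n in sequentially.
      - of_real \<gamma> * of_real (r n) * ((exp (\<i> * \<theta> (Suc n)) - 1) / of_real (h n)
      - (exp (- \<i> * \<theta> (Suc n)) - 1) / of_real (h n)) =
      wronskian a (wkb_ansatz \<gamma> \<rho> (\<lambda>n. - \<phi> n)) (wkb_ansatz \<gamma> \<rho> \<phi>) n"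
    using \<phi> h_pos
  proof eventually_elim
    case (elim n)
    define g where "g = complex_of_real ((- \<gamma>) ^ n)"
    have gg: "g * g = 1"
      using \<gamma> by (auto simp: g_def simp flip: power_mult_distrib)
    define q where "q = complex_of_real (real n powr (- \<rho>)) * of_real (real (Suc n) powr (- \<rho>))"
    have 1: "exp (- (\<i> * \<phi> n)) * exp (\<i> * \<phi> (Suc n)) = exp (\<i> * \<theta> (Suc n))"
      "exp (- (\<i> * \<phi> (Suc n))) * exp (\<i> * \<phi> n) = exp (- \<i> * \<theta> (Suc n))"
      by (simp_all add: elim exp_add[symmetric] algebra_simps)
    have "wronskian a (wkb_ansatz \<gamma> \<rho> (\<lambda>n. - \<phi> n)) (wkb_ansatz \<gamma> \<rho> \<phi>) n =
        - of_real \<gamma> * (g * g) * (of_real (a n) * q) *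
        (exp (- (\<i> * \<phi> n)) * exp (\<i> * \<phi> (Suc n)) - exp (- (\<i> * \<phi> (Suc n))) * exp (\<i> * \<phi> n))"
      by (simp add: wronskian_def wkb_ansatz_def g_def q_def algebra_simps)
    also have "\<dots> = - of_real \<gamma> * (of_real (a n) * q) * (exp (\<i> * \<theta> (Suc n)) - exp (- \<i> * \<theta> (Suc n)))"
      unfolding 1 gg by simp
    also have "of_real (a n) * q = of_real (r n) / of_real (h n)"
      using elim by (simp add: r_def q_def)
    finally show ?case
      by (simp add: diff_divide_distrib[symmetric])
  qed
  ultimately show ?thesis by (simp add: filterlim_cong mult_ac)
qed

text \<open>
  For \<open>\<psi> = \<plusminus> \<phi>\<close> the relative residual has order \<open>n powr (- 1/2)\<close>, and the product of the two ansatz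
  terms is \<open>n powr (- 2 * \<rho>)\<close>; together this gives \<open>n powr (- \<sigma>)\<close>, which is summable as \<open>\<sigma> > 1\<close>. The pair
  formed by the two signs therefore meets the requirements of \<open>approximate_solution_pair\<close>, although
  \<open>Im (\<theta> n)\<close> may be much smaller than \<open>\<theta> n\<close>.
\<close>

lemma asymptotics_real_phase:
  fixes F f \<phi> \<theta> :: "nat \<Rightarrow> complex"
  assumes \<gamma>: "\<gamma> \<in> {1, -1}" and \<sigma>: "1 < \<sigma>" "\<sigma> \<le> 3 / 2"
    and a: "(\<lambda>n. a n / real n powr \<sigma> - (1 + \<alpha> / real n)) \<in> O(\<lambda>n. 1 / real n ^ 2)"
    and a_lim: "(\<lambda>n. a n / real n powr \<sigma>) \<longlonglongrightarrow> 1"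
    and b: "(\<lambda>n. b n / (2 * \<gamma> * real n powr \<sigma>) - (1 + \<beta> / real n)) \<in> O(\<lambda>n. 1 / real n ^ 2)"
    and \<tau>: "\<tau> = 2 * \<beta> - 2 * \<alpha> + \<sigma>" and \<rho>: "\<rho> = \<sigma> / 2 - 1 / 4"
    and F: "jacobi_solution a b z F" and f: "jacobi_solution a b z f"
    and f_asymp: "(\<lambda>n. f n / wkb_ansatz \<gamma> \<rho> \<phi> n) \<longlonglongrightarrow> 1"
    and \<phi>: "\<forall>\<^sub>F n in sequentially. \<phi> (Suc n) = \<phi> n + \<theta> (Suc n)"
    and \<theta>: "(\<lambda>n. \<theta> n / of_real (real n powr (2 * \<rho> - \<sigma>))) \<longlonglongrightarrow> \<kappa>" and \<kappa>: "\<kappa> \<noteq> 0"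
    and sq: "\<forall>\<^sub>F n in sequentially. (\<theta> n)\<^sup>2 = tn \<sigma> \<tau> n (of_real \<gamma> * z)"
    and Im: "\<forall>\<^sub>F n in sequentially. 0 \<le> Im (\<theta> n)"
    and div: "\<not> summable (\<lambda>n. Im (\<theta> n))"
  shows "(\<lambda>n. F n / wkb_ansatz \<gamma> \<rho> (\<lambda>n. - \<phi> n) n) \<longlonglongrightarrow>
    \<i> * of_real \<gamma> * wronskian a F f k / (2 * \<kappa>)"
proof -
  define A where "A = wkb_ansatz \<gamma> \<rho> \<phi>"
  define B where "B = wkb_ansatz \<gamma> \<rho> (\<lambda>n. - \<phi> n)"
  define e where "e = (\<lambda>n. exp (2 * \<i> * \<phi> n))"
  define w where "w = - 2 * \<i> * of_real \<gamma> * \<kappa>"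
  have exponent: "2 * \<rho> - \<sigma> = - 1 / 2" using \<rho> by simp
  have s: "(\<lambda>n. \<theta> n / npow (- 1 / 2) n) \<longlonglongrightarrow> \<kappa>"
    using \<theta> unfolding npow_def exponent .
  have RA: "(\<lambda>n. residual a b z A n / A n) \<in> O(npow (- 1 / 2))"
    unfolding A_def by (rule relative_residual_bigo[OF \<gamma> \<sigma> a b \<tau> \<rho> \<phi> s \<kappa> sq])
  have RB: "(\<lambda>n. residual a b z B n / B n) \<in> O(npow (- 1 / 2))"
    unfolding B_def
  proof (rule relative_residual_bigo[OF \<gamma> \<sigma> a b \<tau> \<rho>, where s = "\<lambda>n. - \<theta> n" and \<kappa> = "- \<kappa>"])
    show "(\<lambda>n. - \<theta> n / npow (- 1 / 2) n) \<longlonglongrightarrow> - \<kappa>"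
      using tendsto_minus[OF s] by simp
    show "\<forall>\<^sub>F n in sequentially. - \<phi> (Suc n) = - \<phi> n + - \<theta> (Suc n)"
      using \<phi> by eventually_elim simp
  qed (use \<kappa> sq in auto)
  have AB: "A n * B n = npow (- (2 * \<rho>)) n" for n
  proof -
    have "A n * B n = of_real (((- \<gamma>) ^ n * (- \<gamma>) ^ n) * (real n powr (- \<rho>) * real n powr (- \<rho>)))
        * (exp (\<i> * \<phi> n) * exp (\<i> * - \<phi> n))"
      by (simp add: A_def B_def wkb_ansatz_def mult_ac)
    also have "(- \<gamma>) ^ n * (- \<gamma>) ^ n = 1"
      using \<gamma> by (auto simp flip: power_mult_distrib)
    also have "exp (\<i> * \<phi> n) * exp (\<i> * - \<phi> n) = 1"
      by (simp add: exp_add[symmetric])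
    finally show ?thesis by (simp add: npow_def powr_add[symmetric])
  qed
  have AB0: "\<forall>\<^sub>F n in sequentially. A n \<noteq> 0 \<and> B n \<noteq> 0"
    using eventually_ge_at_top[of 1]
    by eventually_elim (use \<gamma> in \<open>auto simp: A_def B_def wkb_ansatz_nonzero\<close>)
  have weight: "(\<lambda>n. A n * B n * R n) \<in> O(npow (- \<sigma>))" if "R \<in> O(npow (- 1 / 2))" for R
    unfolding AB by (rule npow_bigo_mult[OF landau_o.big_refl that]) (simp add: \<rho>)
  have "(\<lambda>n. B n * residual a b z A n) \<in> O(npow (- \<sigma>))"
    by (rule landau_o.big.in_cong[THEN iffD1, OF _ weight[OF RA]])
      (use AB0 in \<open>eventually_elim, simp\<close>)
  then obtain C1 where C1: "\<forall>\<^sub>F n in sequentially. norm (B n * residual a b z A n) \<le> C1 * norm (npow (- \<sigma>) n)"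
    by (auto elim: landau_o.bigE)
  have "(\<lambda>n. A n * residual a b z B n) \<in> O(npow (- \<sigma>))"
    by (rule landau_o.big.in_cong[THEN iffD1, OF _ weight[OF RB]])
      (use AB0 in \<open>eventually_elim, simp\<close>)
  then obtain C2 where C2: "\<forall>\<^sub>F n in sequentially. norm (A n * residual a b z B n) \<le> C2 * norm (npow (- \<sigma>) n)"
    by (auto elim: landau_o.bigE)
  define \<eta> where "\<eta> = (\<lambda>n. max C1 C2 * real n powr (- \<sigma>))"
  interpret approximate_solution_pair a b z A B e \<eta> w
  proof
    show "\<forall>\<^sub>F n in sequentially. B n \<noteq> 0 \<and> e n \<noteq> 0"
      using AB0 by eventually_elim (simp add: e_def)
    have "A n = e n * B n" for n
      by (simp add: A_def B_def e_def wkb_ansatz_def exp_add[symmetric] algebra_simps)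
    then show "\<forall>\<^sub>F n in sequentially. A n = e n * B n"
      by simp
    show "e \<longlonglongrightarrow> 0"
      unfolding e_def by (rule exp_twice_phase_to_0[OF \<phi> Im div])
    have "\<forall>\<^sub>F n in sequentially. 0 \<le> Im (\<theta> (Suc n))"
      using Im eventually_sequentially_Suc[of "\<lambda>n. 0 \<le> Im (\<theta> n)"] by simp
    with \<phi> show "\<forall>\<^sub>F n in sequentially. norm (e (Suc n)) \<le> norm (e n)"
      by eventually_elim (simp add: e_def)
    show "summable \<eta>"
      unfolding \<eta>_def using \<sigma> by (intro summable_mult) (simp add: summable_real_powr_iff)
    have mono: "c * norm (npow (- \<sigma>) n) \<le> \<eta> n" if "c \<le> max C1 C2" for c n
      using mult_right_mono[OF that, of "real n powr (- \<sigma>)"] by (simp add: \<eta>_def npow_def)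
    show "\<forall>\<^sub>F n in sequentially. norm (B n * residual a b z A n) \<le> \<eta> n"
      using C1 by eventually_elim (use mono[of C1] in \<open>auto intro: order_trans\<close>)
    show "\<forall>\<^sub>F n in sequentially. norm (A n * residual a b z B n) \<le> \<eta> n"
      using C2 by eventually_elim (use mono[of C2] in \<open>auto intro: order_trans\<close>)
    show "wronskian a B A \<longlonglongrightarrow> w"
      unfolding A_def B_def w_def
      by (rule wkb_ansatz_wronskian_limit[OF \<gamma> a_lim _ \<phi> \<theta>]) (simp add: \<rho>)
    show "w \<noteq> 0"
      using \<kappa> \<gamma> by (auto simp: w_def)
  qed
  have "(\<lambda>n. F n / B n) \<longlonglongrightarrow> wronskian a F f k / w"
    using F f f_asymp unfolding A_def[symmetric] by (rule solution_over_B_tendsto)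
  moreover have "wronskian a F f k / w = \<i> * of_real \<gamma> * wronskian a F f k / (2 * \<kappa>)"
  proof -
    have "(\<i> * of_real \<gamma> * wronskian a F f k) * (- \<i> * of_real \<gamma>) =
        - ((\<i> * \<i>) * of_real (\<gamma> * \<gamma>) * wronskian a F f k)"
      by (simp only: mult_minus_left mult_minus_right of_real_mult mult_ac)
    also have "\<dots> = wronskian a F f k"
      using \<gamma> by auto
    finally have "wronskian a F f k = (\<i> * of_real \<gamma> * wronskian a F f k) * (- \<i> * of_real \<gamma>)"
      by (rule sym)
    moreover have "w = 2 * \<kappa> * (- \<i> * of_real \<gamma>)"
      by (simp add: w_def)
    moreover have "- \<i> * of_real \<gamma> \<noteq> 0" using \<gamma> by auto
    ultimately show ?thesis
      using nonzero_mult_divide_mult_cancel_right[of "- \<i> * of_real \<gamma>"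
          "\<i> * of_real \<gamma> * wronskian a F f k" "2 * \<kappa>"] by simp
  qed
  ultimately show ?thesis
    by (simp add: B_def)
qed

text \<open>
  Here \<open>n * tn\<close> tends to the point \<open>- \<tau>\<close> on the cut, where \<open>upper_sqrt\<close> is discontinuous. It
  approaches the point from one side, the one given by the sign \<open>\<epsilon>\<close> of \<open>Im \<zeta>\<close>, and on that side
  \<open>upper_sqrt\<close> agrees with \<open>\<epsilon>\<close> times the principal root, which is continuous at \<open>- \<tau>\<close>.
\<close>

lemma theta_leading_term_real:
  assumes \<sigma>: "1 < \<sigma>" and \<tau>: "\<tau> < 0" and \<zeta>: "Im \<zeta> \<noteq> 0"
  shows "(\<lambda>n. theta \<sigma> \<tau> L p n \<zeta> / of_real (real n powr (- 1 / 2))) \<longlonglongrightarrow> kappa \<sigma> \<tau> \<zeta>"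
proof -
  define \<epsilon> where "\<epsilon> = (if Im \<zeta> > 0 then 1 else - 1 :: real)"
  have \<epsilon>: "\<epsilon> * \<epsilon> = 1" "\<epsilon> * Im \<zeta> > 0"
    using \<zeta> by (auto simp: \<epsilon>_def)
  define y where "y = (\<lambda>n. upper_sqrt (of_nat n * tn \<sigma> \<tau> n \<zeta>))"
  have lim: "(\<lambda>n. of_nat n * tn \<sigma> \<tau> n \<zeta>) \<longlonglongrightarrow> of_real (- \<tau>)"
  proof -
    have "(\<lambda>n. of_real (real n powr 1) * tn \<sigma> \<tau> n \<zeta>) \<longlonglongrightarrow> of_real (- \<tau>)"
      using tn_scaled_limit[of 1 \<sigma> \<tau> \<zeta>] \<sigma> by simp
    then show ?thesis by simp
  qed
  have "isCont csqrt (of_real (- \<tau>))"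
    using \<tau> by (intro continuous_at_csqrt) (simp add: complex_nonpos_Reals_iff)
  from isCont_tendsto_compose[OF this lim]
  have "(\<lambda>n. csqrt (of_nat n * tn \<sigma> \<tau> n \<zeta>)) \<longlonglongrightarrow> of_real (sqrt (- \<tau>))"
    using csqrt_of_real[of "- \<tau>"] \<tau> by simp
  then have "(\<lambda>n. of_real \<epsilon> * csqrt (of_nat n * tn \<sigma> \<tau> n \<zeta>)) \<longlonglongrightarrow> of_real \<epsilon> * of_real (sqrt (- \<tau>))"
    by (intro tendsto_mult tendsto_const)
  moreover have "of_real \<epsilon> * of_real (sqrt (- \<tau>)) = kappa \<sigma> \<tau> \<zeta>"
    using \<sigma> \<tau> \<zeta> by (auto simp: kappa_def \<epsilon>_def)
  moreover have "\<forall>\<^sub>F n in sequentially. of_real \<epsilon> * csqrt (of_nat n * tn \<sigma> \<tau> n \<zeta>) =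
      theta \<sigma> \<tau> L p n \<zeta> / of_real (real n powr (- 1 / 2))"
    using eventually_gt_at_top[of 0]
  proof eventually_elim
    case (elim n)
    have "Im (of_nat n * tn \<sigma> \<tau> n \<zeta>) = real n * real n powr (- \<sigma>) * Im \<zeta>"
      by (simp add: tn_def)
    then have eq: "\<epsilon> * Im (of_nat n * tn \<sigma> \<tau> n \<zeta>) = (real n * real n powr (- \<sigma>)) * (\<epsilon> * Im \<zeta>)"
      by (simp only: mult_ac)
    have Im_pos: "\<epsilon> * Im (of_nat n * tn \<sigma> \<tau> n \<zeta>) > 0"
      unfolding eq by (rule mult_pos_pos[OF _ \<epsilon>(2)]) (use elim in simp)
    have y2: "(y n)\<^sup>2 = of_nat n * tn \<sigma> \<tau> n \<zeta>"
      by (simp add: y_def upper_sqrt_power2)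
    have "of_nat n * tn \<sigma> \<tau> n \<zeta> \<notin> nonneg_axis"
    proof
      assume "of_nat n * tn \<sigma> \<tau> n \<zeta> \<in> nonneg_axis"
      then have "Im (of_nat n * tn \<sigma> \<tau> n \<zeta>) = 0"
        unfolding nonneg_axis_def by (metis Im_complex_of_real imageE)
      with Im_pos show False by (metis less_irrefl mult_zero_right)
    qed
    then have Im_y: "Im (y n) > 0"
      unfolding y_def by (rule Im_upper_sqrt_pos)
    have "Im (of_nat n * tn \<sigma> \<tau> n \<zeta>) = 2 * Re (y n) * Im (y n)"
      unfolding y2[symmetric] by (simp add: Im_power2)
    with Im_pos have "0 < (\<epsilon> * Re (y n)) * (2 * Im (y n))"
      by (simp add: mult_ac)
    then have "0 < \<epsilon> * Re (y n)"
      using Im_y by (simp add: zero_less_mult_iff)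
    moreover have "(of_real \<epsilon> * y n)\<^sup>2 = of_real (\<epsilon> * \<epsilon>) * (y n)\<^sup>2"
      by (simp add: power2_eq_square)
    ultimately have "csqrt (of_nat n * tn \<sigma> \<tau> n \<zeta>) = of_real \<epsilon> * y n"
      using \<epsilon>(1) y2 by (intro csqrt_unique) auto
    then have 1: "of_real \<epsilon> * csqrt (of_nat n * tn \<sigma> \<tau> n \<zeta>) = y n"
      using \<epsilon>(1) by (metis mult.assoc mult_1 of_real_1 of_real_mult)
    have "y n = of_real (sqrt (real n)) * upper_sqrt (tn \<sigma> \<tau> n \<zeta>)"
      using upper_sqrt_scale[of "real n" "tn \<sigma> \<tau> n \<zeta>"] elim by (simp add: y_def)
    then show ?case
      unfolding 1 using \<sigma> elim by (simp add: theta_def powr_minus powr_half_sqrt field_simps)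
  qed
  ultimately show ?thesis by (simp add: filterlim_cong)
qed

text \<open>
  From \<open>Im (\<theta>\<^sup>2) = 2 Re \<theta> Im \<theta>\<close> with \<open>|Im (\<theta>\<^sup>2)| = |Im \<zeta>| n powr (- \<sigma>)\<close> and \<open>|\<theta>|\<close> of order
  \<open>n powr (- 1/2)\<close>, the imaginary part is at least of order \<open>n powr (1/2 - \<sigma>)\<close>. This is where
  \<open>\<sigma> \<le> 3/2\<close> is essential: the harmonic series is the borderline.
\<close>

lemma Im_theta_not_summable:
  assumes \<sigma>: "1 < \<sigma>" "\<sigma> \<le> 3 / 2" and \<tau>: "\<tau> < 0" and \<zeta>: "Im \<zeta> \<noteq> 0"
    and off_cut: "\<forall>\<^sub>F n in sequentially. theta_defined \<sigma> \<tau> L p n \<zeta>"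
  shows "\<not> summable (\<lambda>n. Im (theta \<sigma> \<tau> L p n \<zeta>))"
proof
  assume sum: "summable (\<lambda>n. Im (theta \<sigma> \<tau> L p n \<zeta>))"
  \<comment> \<open>Eventually \<open>2 * |\<theta> n| \<le> C * n powr (- 1/2)\<close>.\<close>
  define C where "C = 2 * (norm (kappa \<sigma> \<tau> \<zeta>) + 1)"
  have C: "C > 0" by (simp add: C_def add_pos_nonneg add.commute)
  have "(\<lambda>n. norm (theta \<sigma> \<tau> L p n \<zeta> / of_real (real n powr (- 1 / 2)))) \<longlonglongrightarrow> norm (kappa \<sigma> \<tau> \<zeta>)"
    using \<sigma> \<tau> \<zeta> by (intro tendsto_norm theta_leading_term_real)
  then have "\<forall>\<^sub>F n in sequentially.
      norm (theta \<sigma> \<tau> L p n \<zeta> / of_real (real n powr (- 1 / 2))) < norm (kappa \<sigma> \<tau> \<zeta>) + 1"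
    by (rule order_tendstoD(2)) simp
  then have lower: "\<forall>\<^sub>F n in sequentially.
      norm (real n powr (- 1) * \<bar>Im \<zeta>\<bar>) \<le> C * Im (theta \<sigma> \<tau> L p n \<zeta>)"
    using off_cut eventually_ge_at_top[of 1]
  proof eventually_elim
    case (elim n)
    define s where "s = theta \<sigma> \<tau> L p n \<zeta>"
    define h where "h = real n powr (- 1 / 2)"
    have h: "h > 0" using elim by (simp add: h_def)
    have s: "s = upper_sqrt (tn \<sigma> \<tau> n \<zeta>)"
      using \<sigma> by (simp add: s_def theta_def)
    have Im_s: "Im s > 0"
      using elim \<sigma> unfolding s theta_defined_def by (auto intro: Im_upper_sqrt_pos)
    have "norm s / h < norm (kappa \<sigma> \<tau> \<zeta>) + 1"
      using elim(1) by (simp add: s_def h_def norm_divide)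
    then have "norm s \<le> C / 2 * h"
      using h by (simp add: C_def field_simps)
    have "real n powr (- \<sigma>) * \<bar>Im \<zeta>\<bar> = \<bar>Im (s\<^sup>2)\<bar>"
      unfolding s upper_sqrt_power2 by (simp add: tn_def abs_mult)
    also have "\<dots> = 2 * \<bar>Re s\<bar> * Im s"
      using Im_s by (simp add: Im_power2 abs_mult)
    also have "\<dots> \<le> 2 * (C / 2 * h) * Im s"
      using abs_Re_le_cmod[of s] \<open>norm s \<le> C / 2 * h\<close> Im_s
      by (intro mult_right_mono mult_left_mono) auto
    finally have 1: "real n powr (- \<sigma>) * \<bar>Im \<zeta>\<bar> \<le> h * (C * Im s)"
      by (simp add: mult_ac)
    have "h * real n powr (- 1) = real n powr (- 3 / 2)"
      using powr_add[of "real n" "- 1 / 2" "- 1"] by (simp add: h_def)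
    also have "\<dots> \<le> real n powr (- \<sigma>)"
      using \<sigma> elim by (intro powr_mono) auto
    finally have "h * real n powr (- 1) * \<bar>Im \<zeta>\<bar> \<le> real n powr (- \<sigma>) * \<bar>Im \<zeta>\<bar>"
      by (intro mult_right_mono) auto
    also note 1
    finally have "h * (real n powr (- 1) * \<bar>Im \<zeta>\<bar>) \<le> h * (C * Im s)"
      by (simp add: mult.assoc)
    from mult_left_le_imp_le[OF this h] show ?case
      by (simp add: s_def)
  qed
  have "summable (\<lambda>n. real n powr (- 1) * \<bar>Im \<zeta>\<bar>)"
    by (rule summable_comparison_test_ev[OF lower]) (intro summable_mult sum)
  from summable_mult2[OF this, of "inverse \<bar>Im \<zeta>\<bar>"]
  have "summable (\<lambda>n. real n powr (- 1))"
    using \<zeta> by (simp add: mult.assoc del: powr_neg_one)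
  then show False
    using summable_real_powr_iff[of "- 1"] by simp
qed

section \<open>Asymptotics of an arbitrary solution\<close>

lemma leading_coefficient_limit:
  assumes "(\<lambda>n. a n / real n powr \<sigma> - (1 + \<alpha> / real n)) \<in> O(\<lambda>n. 1 / real n ^ 2)"
  shows "(\<lambda>n. a n / real n powr \<sigma>) \<longlonglongrightarrow> 1"
proof -
  have "(\<lambda>n. 1 / real n ^ 2) \<in> o(\<lambda>n. 1 :: real)"
    by real_asymp
  with assms have "(\<lambda>n. a n / real n powr \<sigma> - (1 + \<alpha> / real n)) \<in> o(\<lambda>n. 1)"
    by (rule landau_o.big_small_trans)
  then have 1: "(\<lambda>n. a n / real n powr \<sigma> - (1 + \<alpha> / real n)) \<longlonglongrightarrow> 0"
    using smalloD_tendsto by fastforce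
  have "(\<lambda>n. 1 + \<alpha> * (1 / real n)) \<longlonglongrightarrow> 1 + \<alpha> * 0"
    by (intro tendsto_intros lim_1_over_n)
  from tendsto_add[OF 1 this] show ?thesis by simp
qed

theorem theorem6p6:
  fixes \<gamma> \<sigma> \<alpha> \<beta> \<tau> :: real
    and a b :: "nat \<Rightarrow> real"
    and L N k :: nat
    and p :: "nat \<Rightarrow> real"
    and z :: complex
    and f F :: "nat \<Rightarrow> complex"
  assumes gamma: "\<gamma> \<in> {1, -1}"
    and sigma: "0 < \<sigma>" "\<sigma> \<le> 3 / 2"
    and a_pos: "\<And>n. a n > 0"
    and a_asymp: "(\<lambda>n. a n / real n powr \<sigma> - (1 + \<alpha> / real n)) \<in> O(\<lambda>n. 1 / real n ^ 2)"
    and b_asymp: "(\<lambda>n. b n / (2 * \<gamma> * real n powr \<sigma>) - (1 + \<beta> / real n)) \<in> O(\<lambda>n. 1 / real n ^ 2)"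
    and tau: "\<tau> = 2 * \<beta> - 2 * \<alpha> + \<sigma>"
    and cases:
      "(\<sigma> > 1 \<and> (\<tau> < 0 \<and> Im z \<noteq> 0 \<or> \<tau> > 0)) \<or>
       (\<sigma> < 1 \<and> (\<gamma> > 0 \<and> z \<notin> of_real ` {0..} \<or> \<gamma> < 0 \<and> z \<notin> of_real ` {..0})) \<or>
       (\<sigma> = 1 \<and> (\<gamma> > 0 \<and> z \<notin> of_real ` {\<tau>..} \<or> \<gamma> < 0 \<and> z \<notin> of_real ` {..- \<tau>}))"
    and z_off: "z \<notin> closure (spectral_set \<gamma> \<sigma> \<tau>)"
    and L_p: "\<sigma> < 1 \<Longrightarrow> phase_coeffs \<sigma> L p"
    and N: "\<And>m. m \<ge> N \<Longrightarrow> theta_defined \<sigma> \<tau> L p m (of_real \<gamma> * z)"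
    and f: "jost_solution \<gamma> \<sigma> \<tau> L p N a b z f"
    and F: "jacobi_solution a b z F"
  shows
    "let W = wronskian a F f k;
         A = (\<lambda>n. of_real ((- \<gamma>) ^ (n + 1) * real n powr (- rho \<sigma>)) *
                   exp (- \<i> * phi \<sigma> \<tau> L p N n (of_real \<gamma> * z)))
     in (W \<noteq> 0 \<longrightarrow> F \<sim>[sequentially] (\<lambda>n. - \<i> * W / (2 * kappa \<sigma> \<tau> (of_real \<gamma> * z)) * A n)) \<and>
        (W = 0 \<longrightarrow> F \<in> o[sequentially](A))"
proof -
  define \<zeta> where "\<zeta> = of_real \<gamma> * z"
  define W where "W = wronskian a F f k"
  define \<kappa> where "\<kappa> = kappa \<sigma> \<tau> \<zeta>"
  define \<phi> where "\<phi> = (\<lambda>n. phi \<sigma> \<tau> L p N n \<zeta>)"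
  define \<theta> where "\<theta> = (\<lambda>n. theta \<sigma> \<tau> L p n \<zeta>)"
  define A where "A = (\<lambda>n. of_real ((- \<gamma>) ^ (n + 1) * real n powr (- rho \<sigma>)) * exp (- \<i> * \<phi> n))"
  define B where "B = wkb_ansatz \<gamma> (rho \<sigma>) (\<lambda>n. - \<phi> n)"
  have \<gamma>0: "\<gamma> \<noteq> 0" using gamma by auto
  have a_lim: "(\<lambda>n. a n / real n powr \<sigma>) \<longlonglongrightarrow> 1"
    by (rule leading_coefficient_limit[OF a_asymp])
  have fj: "jacobi_solution a b z f"
    using f by (simp add: jost_solution_def)
  have f_lim: "(\<lambda>n. f n / wkb_ansatz \<gamma> (rho \<sigma>) \<phi> n) \<longlonglongrightarrow> 1"
  proof -
    have "f \<sim>[sequentially] wkb_ansatz \<gamma> (rho \<sigma>) \<phi>"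
      using f by (simp add: jost_solution_def wkb_ansatz_def[abs_def] \<phi>_def \<zeta>_def)
    from asymp_equivD[OF this] show ?thesis
    proof (rule Lim_transform_eventually)
      show "\<forall>\<^sub>F n in sequentially. (if f n = 0 \<and> wkb_ansatz \<gamma> (rho \<sigma>) \<phi> n = 0 then 1
          else f n / wkb_ansatz \<gamma> (rho \<sigma>) \<phi> n) = f n / wkb_ansatz \<gamma> (rho \<sigma>) \<phi> n"
        using eventually_ge_at_top[of 1] by eventually_elim (simp add: wkb_ansatz_nonzero \<gamma>0)
    qed
  qed
  have \<phi>_Suc: "\<forall>\<^sub>F n in sequentially. \<phi> (Suc n) = \<phi> n + \<theta> (Suc n)"
    using eventually_ge_at_top[of N] by eventually_elim (simp add: \<phi>_def \<theta>_def phi_def)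
  have defined: "\<forall>\<^sub>F n in sequentially. theta_defined \<sigma> \<tau> L p n \<zeta>"
    using eventually_ge_at_top[of N] by eventually_elim (simp add: N \<zeta>_def)
  have B_lim: "(\<lambda>n. F n / B n) \<longlonglongrightarrow> \<i> * of_real \<gamma> * W / (2 * \<kappa>)" and \<kappa>0: "\<kappa> \<noteq> 0"
  proof -
    have "(\<lambda>n. F n / B n) \<longlonglongrightarrow> \<i> * of_real \<gamma> * W / (2 * \<kappa>) \<and> \<kappa> \<noteq> 0"
    \<comment> \<open>Exactly in this case \<open>\<kappa>\<close> is real and the phase is dominated by its oscillating part.\<close>
    proof (cases "1 < \<sigma> \<and> \<tau> < 0")
      case True
      then have \<sigma>: "1 < \<sigma>" and \<tau>: "\<tau> < 0" by auto
      have \<zeta>: "Im \<zeta> \<noteq> 0"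
        using cases True \<gamma>0 by (auto simp: \<zeta>_def)
      have \<rho>: "rho \<sigma> = \<sigma> / 2 - 1 / 4" and exponent: "2 * rho \<sigma> - \<sigma> = - 1 / 2"
        using \<sigma> by (auto simp: rho_def)
      have \<kappa>: "\<kappa> \<noteq> 0"
        using \<sigma> \<tau> by (simp add: \<kappa>_def kappa_def)
      have \<theta>_lim: "(\<lambda>n. \<theta> n / of_real (real n powr (2 * rho \<sigma> - \<sigma>))) \<longlonglongrightarrow> \<kappa>"
        unfolding exponent \<theta>_def \<kappa>_def by (rule theta_leading_term_real[OF \<sigma> \<tau> \<zeta>])
      have sq: "\<forall>\<^sub>F n in sequentially. (\<theta> n)\<^sup>2 = tn \<sigma> \<tau> n (of_real \<gamma> * z)"
        using \<sigma> by (simp add: \<theta>_def theta_def upper_sqrt_power2 \<zeta>_def)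
      have Im: "\<forall>\<^sub>F n in sequentially. 0 \<le> Im (\<theta> n)"
        using defined
      proof eventually_elim
        case (elim n)
        then show ?case
          using Im_upper_sqrt_pos[of "tn \<sigma> \<tau> n \<zeta>"] \<sigma> by (simp add: \<theta>_def theta_def theta_defined_def)
      qed
      have "\<not> summable (\<lambda>n. Im (\<theta> n))"
        unfolding \<theta>_def by (rule Im_theta_not_summable[OF \<sigma> sigma(2) \<tau> \<zeta> defined])
      then show ?thesis
        using asymptotics_real_phase[OF gamma \<sigma> sigma(2) a_asymp a_lim b_asymp tau \<rho> F fj f_lim
            \<phi>_Suc \<theta>_lim \<kappa> sq Im] \<kappa>
        by (simp add: B_def W_def)
    next
      case False
      have off_cut: "if \<sigma> > 1 then \<tau> > 0 else if \<sigma> = 1 then \<zeta> - of_real \<tau> \<notin> nonneg_axis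
          else \<zeta> \<notin> nonneg_axis"
      proof (cases "\<sigma> < 1")
        case True
        have "\<zeta> \<notin> nonneg_axis"
        proof
          assume "\<zeta> \<in> nonneg_axis"
          then obtain x where x: "x \<ge> 0" "of_real \<gamma> * z = of_real x"
            by (auto simp: nonneg_axis_def \<zeta>_def)
          have "z = of_real \<gamma> * (of_real \<gamma> * z)"
            using gamma by auto
          then have "z = of_real (\<gamma> * x)"
            unfolding x(2) by simp
          with x(1) cases True gamma show False by auto
        qed
        with True show ?thesis by simp
      next
        case False
        show ?thesis
          using False N[of N] cases \<open>\<not> (1 < \<sigma> \<and> \<tau> < 0)\<close> by (auto simp: theta_defined_def \<zeta>_def)
      qed
      note \<theta>_lim = theta_leading_term_nonreal[OF sigma(1) off_cut]
      have "0 < \<sigma> - 2 * rho \<sigma>" "\<sigma> - 2 * rho \<sigma> \<le> 1"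
        using sigma by (auto simp: rho_def)
      then have "(\<lambda>n. F n / B n) \<longlonglongrightarrow> \<i> * of_real \<gamma> * wronskian a F f k / (2 * \<kappa>)"
        unfolding B_def \<kappa>_def
        using \<theta>_lim(2)
        by (intro asymptotics_nonreal_phase[OF gamma a_lim a_pos F fj f_lim \<phi>_Suc])
          (use \<theta>_lim(1) in \<open>auto simp: \<theta>_def\<close>)
      then show ?thesis
        using \<theta>_lim(2) by (auto simp: W_def \<kappa>_def)
    qed
    then show "(\<lambda>n. F n / B n) \<longlonglongrightarrow> \<i> * of_real \<gamma> * W / (2 * \<kappa>)" and "\<kappa> \<noteq> 0" by auto
  qed
  have A_eq: "A n = - of_real \<gamma> * B n" for n
    by (simp add: A_def B_def wkb_ansatz_def)
  have A0: "\<forall>\<^sub>F n in sequentially. A n \<noteq> 0"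
    using eventually_ge_at_top[of 1] by eventually_elim (simp add: A_def \<gamma>0)
  have A_lim: "(\<lambda>n. F n / A n) \<longlonglongrightarrow> - \<i> * W / (2 * \<kappa>)"
  proof -
    have "(\<lambda>n. F n / B n / (- of_real \<gamma>)) \<longlonglongrightarrow> \<i> * of_real \<gamma> * W / (2 * \<kappa>) / (- of_real \<gamma>)"
      using \<gamma>0 by (intro tendsto_divide B_lim tendsto_const) simp
    then show ?thesis
      using \<gamma>0 by (simp add: A_eq mult.commute)
  qed
  have "F \<sim>[sequentially] (\<lambda>n. - \<i> * W / (2 * \<kappa>) * A n)" if W: "W \<noteq> 0"
  proof (rule asymp_equivI')
    have c: "- \<i> * W / (2 * \<kappa>) \<noteq> 0" using W \<kappa>0 by simp
    have "(\<lambda>n. F n / A n / (- \<i> * W / (2 * \<kappa>))) \<longlonglongrightarrow> (- \<i> * W / (2 * \<kappa>)) / (- \<i> * W / (2 * \<kappa>))"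
      by (intro tendsto_divide A_lim tendsto_const c)
    then show "(\<lambda>n. F n / (- \<i> * W / (2 * \<kappa>) * A n)) \<longlonglongrightarrow> 1"
      using c by (simp add: mult.commute)
  qed
  moreover have "F \<in> o(A)" if "W = 0"
    by (rule smalloI_tendsto[OF _ A0]) (use A_lim that in simp)
  ultimately show ?thesis
    by (simp add: Let_def W_def[symmetric] \<kappa>_def \<zeta>_def \<phi>_def A_def)
qed

end
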